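(* The determinants of the set of complex Toeplitz matrices cannot be evaluated accurately using any enumerable set of bounded-degree black-box operations. That is, given any enumerable set of black-box operations of bounded degree, it is not the case that for every $n$ the determinant of the $n$-by-$n$ Toeplitz matrix $T$ with $x_j$ on its $j$-th diagonal ($1-n\le j\le n-1$), as a polynomial in $(x_{1-n},\dots,x_{n-1})\in\mathbb{C}^{2n-1}$, is accurately evaluable on $\mathbb{C}^{2n-1}$ using these operations.
   Context: Toeplitz notation: $x_0$ is on the main diagonal, $x_{n-1}$ is in the top right corner, and $x_{1-n}$ is in the bottom left corner; the $2n-1$ entries are independent complex variables. Black boxes. A black-box operation takes finitely many inputs $x_1,\dots,x_k$ and produces a polynomial $q(x_1,\dots,x_k)$. A set $\{q_j:j\in J\}$ of black-box operations has bounded degree if the degrees of the $q_j$ are bounded by a common constant. The set is always taken to include $x_1x_2$, $x_1+x_2$ and $x_1-x_2$. Extended arithmetic over $\mathbb{C}$. An algorithm using the set $\{q_j\}$ receives its input $x\in\mathbb{C}^N$ exactly and is a finite directed acyclic graph with input, computational, branching and output nodes. Each computational node applies some $q_j$ to its inputs $a_1,\dots,a_l$ (possibly with repetitions) and returns $q_j(a_1,\dots,a_l)(1+\delta_i)$, with $\delta_i\in\mathbb{C}$ a rounding error attached to that node; the $\delta_i$ of different nodes are independent variables. Negation is also available and is exact. The algorithm may or may not use comparisons and branching. It terminates in finitely many steps; its output is $p_{comp}(x,\delta)$, $\delta=(\delta_1,\dots,\delta_k)$, and $p_{comp}(x,0)=p(x)$, where $p$ is the polynomial being evaluated. It is accurate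 for $p$ on a domain $\mathcal{D}\subseteq\mathbb{C}^N$ if for every $0<\eta<1$ there is $0<\epsilon<1$ such that for all $x\in\mathcal{D}$ and all $\delta$ with all $|\delta_i|\le\epsilon$, $|p_{comp}(x,\delta)-p(x)|\le\eta|p(x)|$. The polynomial $p$ is accurately evaluable on $\mathcal{D}$ if an accurate algorithm for $p$ on $\mathcal{D}$ exists. *)

theory Defs
  imports
    Complex_Main
    "HOL-Library.Countable_Set"
    "HOL-Library.FuncSet"
    "HOL-Library.Poly_Mapping"
    "Jordan_Normal_Form.Determinant"
begin

section \<open>Multivariate polynomials\<close>

text \<open>
  A monomial is a finitely supported map from variables to exponents, a polynomial a finitely
  supported map from monomials to complex coefficients. The ring structure is the convolution
  product of \<^theory>\<open>HOL-Library.Poly_Mapping\<close>.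
\<close>

type_synonym 'v mpoly = "('v \<Rightarrow>\<^sub>0 nat) \<Rightarrow>\<^sub>0 complex"

definition mvar :: "'v \<Rightarrow> 'v mpoly" where
  "mvar v = Poly_Mapping.single (Poly_Mapping.single v 1) 1"

definition mvars :: "'v mpoly \<Rightarrow> 'v set" where
  "mvars p = (\<Union>m\<in>Poly_Mapping.keys p. Poly_Mapping.keys m)"

definition monomial_degree :: "('v \<Rightarrow>\<^sub>0 nat) \<Rightarrow> nat" where
  "monomial_degree m = (\<Sum>v\<in>Poly_Mapping.keys m. Poly_Mapping.lookup m v)"

text \<open>The zero polynomial gets total degree 0.\<close>

definition total_degree :: "'v mpoly \<Rightarrow> nat" where
  "total_degree p = Max (insert 0 (monomial_degree ` Poly_Mapping.keys p))"

definition mpoly_eval :: "('v \<Rightarrow> complex) \<Rightarrow> 'v mpoly \<Rightarrow> complex" where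
  "mpoly_eval x p = (\<Sum>m\<in>Poly_Mapping.keys p. Poly_Mapping.lookup p m *
     (\<Prod>v\<in>Poly_Mapping.keys m. x v ^ Poly_Mapping.lookup m v))"


section \<open>Black-box operations\<close>

text \<open>
  A black-box operation is identified with the polynomial it produces; the variable with
  number \<open>i\<close> stands for its \<open>i\<close>-th input, counted from 0.
\<close>

definition basic_operations :: "nat mpoly set" where
  "basic_operations = {mvar 0 * mvar 1, mvar 0 + mvar 1, mvar 0 - mvar 1}"

definition bounded_degree :: "nat mpoly set \<Rightarrow> bool" where
  "bounded_degree B \<longleftrightarrow> (\<exists>d. \<forall>q\<in>B. total_degree q \<le> d)"


section \<open>Algorithms in extended arithmetic\<close>

text \<open>
  An algorithm is a finite directed acyclic graph, given by the list of its nodes in a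
  topological order. An edge is named by the position of the node at its tail; it either passes
  on the value of that node or negates it, without rounding error.
\<close>

datatype edge = Plain (tail: nat) | Negated (tail: nat)

text \<open>
  A branching node \<open>Branch R a b c d\<close> compares the values arriving along \<open>a\<close> and \<open>b\<close> by
  the relation \<open>R\<close>, and passes on the value arriving along \<open>c\<close> if \<open>R\<close> holds and the one
  arriving along \<open>d\<close> otherwise. All operations being total, it makes no difference that the
  nodes of the branch not taken receive values too: the output does not depend on them or on
  their rounding errors. The output node is represented by its incoming edge.
\<close>

datatype 'v node =
    Input 'v
  | Compute "nat mpoly" "edge list"
  | Branch "complex \<Rightarrow> complex \<Rightarrow> bool" edge edge edge edge

datatype 'v algorithm = Algorithm (nodes: "'v node list") (out_edge: edge)

text \<open>
  \<open>R\<close> is the set of available comparisons, \<open>B\<close> the set of black-box operations, \<open>I\<close> the set of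
  input variables, and \<open>m\<close> the position of the node. Edges may be repeated.
\<close>

fun wf_node ::
  "(complex \<Rightarrow> complex \<Rightarrow> bool) set \<Rightarrow> nat mpoly set \<Rightarrow> 'v set \<Rightarrow> nat \<Rightarrow> 'v node \<Rightarrow> bool" where
  "wf_node R B I m (Input v) \<longleftrightarrow> v \<in> I"
| "wf_node R B I m (Compute q es) \<longleftrightarrow>
     q \<in> B \<and> mvars q \<subseteq> {..<length es} \<and> (\<forall>e\<in>set es. tail e < m)"
| "wf_node R B I m (Branch r a b c d) \<longleftrightarrow> r \<in> R \<and> (\<forall>e\<in>{a, b, c, d}. tail e < m)"

definition wf_algorithm ::
  "(complex \<Rightarrow> complex \<Rightarrow> bool) set \<Rightarrow> nat mpoly set \<Rightarrow> 'v set \<Rightarrow> 'v algorithm \<Rightarrow> bool" where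
  "wf_algorithm R B I A \<longleftrightarrow>
     (\<forall>m<length (nodes A). wf_node R B I m (nodes A ! m)) \<and>
     tail (out_edge A) < length (nodes A)"

text \<open>Below, \<open>vs\<close> lists the values of the preceding nodes.\<close>

fun edge_value :: "complex list \<Rightarrow> edge \<Rightarrow> complex" where
  "edge_value vs (Plain i) = vs ! i"
| "edge_value vs (Negated i) = - (vs ! i)"

fun node_value :: "('v \<Rightarrow> complex) \<Rightarrow> complex \<Rightarrow> complex list \<Rightarrow> 'v node \<Rightarrow> complex" where
  "node_value x d vs (Input v) = x v"
| "node_value x d vs (Compute q es) = mpoly_eval (\<lambda>i. edge_value vs (es ! i)) q * (1 + d)"
| "node_value x d vs (Branch r a b c e) =
     (if r (edge_value vs a) (edge_value vs b) then edge_value vs c else edge_value vs e)"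

text \<open>
  The rounding error of the computational node at position \<open>m\<close> is \<open>\<delta> m\<close>; the values of \<open>\<delta>\<close> at
  all other positions are not used.
\<close>

definition node_values :: "('v \<Rightarrow> complex) \<Rightarrow> (nat \<Rightarrow> complex) \<Rightarrow> 'v node list \<Rightarrow> complex list" where
  "node_values x \<delta> ns = foldl (\<lambda>vs n. vs @ [node_value x (\<delta> (length vs)) vs n]) [] ns"

definition p_comp :: "'v algorithm \<Rightarrow> ('v \<Rightarrow> complex) \<Rightarrow> (nat \<Rightarrow> complex) \<Rightarrow> complex" where
  "p_comp A x \<delta> = edge_value (node_values x \<delta> (nodes A)) (out_edge A)"


section \<open>Accurate evaluability\<close>

abbreviation complex_space :: "'v set \<Rightarrow> ('v \<Rightarrow> complex) set" where
  "complex_space I \<equiv> I \<rightarrow>\<^sub>E UNIV"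

definition algorithm_for ::
  "(complex \<Rightarrow> complex \<Rightarrow> bool) set \<Rightarrow> nat mpoly set \<Rightarrow> 'v set \<Rightarrow> 'v mpoly \<Rightarrow> 'v algorithm \<Rightarrow> bool"
  where
  "algorithm_for R B I p A \<longleftrightarrow>
     wf_algorithm R B I A \<and> (\<forall>x\<in>complex_space I. p_comp A x (\<lambda>_. 0) = mpoly_eval x p)"

definition accurate_on :: "('v \<Rightarrow> complex) set \<Rightarrow> 'v mpoly \<Rightarrow> 'v algorithm \<Rightarrow> bool" where
  "accurate_on D p A \<longleftrightarrow>
     (\<forall>\<eta>::real. 0 < \<eta> \<and> \<eta> < 1 \<longrightarrow>
       (\<exists>\<epsilon>::real. 0 < \<epsilon> \<and> \<epsilon> < 1 \<and>
         (\<forall>x\<in>D. \<forall>\<delta>. (\<forall>i. norm (\<delta> i) \<le> \<epsilon>) \<longrightarrow>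
            norm (p_comp A x \<delta> - mpoly_eval x p) \<le> \<eta> * norm (mpoly_eval x p))))"

definition accurately_evaluable ::
  "(complex \<Rightarrow> complex \<Rightarrow> bool) set \<Rightarrow> nat mpoly set \<Rightarrow> 'v set \<Rightarrow> ('v \<Rightarrow> complex) set \<Rightarrow> 'v mpoly \<Rightarrow> bool"
  where
  "accurately_evaluable R B I D p \<longleftrightarrow> (\<exists>A. algorithm_for R B I p A \<and> accurate_on D p A)"


section \<open>Toeplitz determinants\<close>

definition toeplitz_indices :: "nat \<Rightarrow> int set" where
  "toeplitz_indices n = {1 - int n..int n - 1}"

definition toeplitz_matrix :: "nat \<Rightarrow> int mpoly mat" where
  "toeplitz_matrix n = mat n n (\<lambda>(i, j). mvar (int j - int i))"

definition toeplitz_det :: "nat \<Rightarrow> int mpoly" where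
  "toeplitz_det n = det (toeplitz_matrix n)"

end

theory Submission
  imports Defs "HOL-Analysis.Product_Vector"
begin

text \<open>
  Take an accurate algorithm for a single size \<open>n \<ge> 3\<close> that exceeds the common bound of the degrees.
  It can be confused: there are a singular and a nonsingular Toeplitz matrix on which it may return the
  same value.

  Low degree operations do not see singularity. Every point of the form
  \<open>x k = (\<Sum>l<n-1. \<alpha> l * \<rho> l ^ (k + n - 1))\<close> gives a singular matrix
  (\<open>det_toeplitz_secant\<close>). These points form a secant variety of a rational normal curve, and no
  nonzero polynomial of degree less than \<open>n\<close> vanishes on it
  (\<open>vanishes_on_secants_imp_zero\<close>). Now follow a run of the algorithm at a generic such point with
  generic rounding errors. An operation is applied to inputs and to rounded values; the latter can be
  treated as independent constants, and the operation has degree less than \<open>n\<close> in the inputs. So if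
  its result is 0, it is 0 for all inputs; and if it is nonzero, then for nearby inputs the rounding
  errors can be adjusted so that the rounded value does not change at all. Hence there are, for all
  branching patterns simultaneously, fixed values of the computational nodes that are feasible in a whole
  neighbourhood of the generic point (\<open>universal_history\<close>, \<open>feasible_nearby\<close>).

  Without branching little would remain to be done. With branching, the comparisons are arbitrary
  relations, and they may be applied to inputs, which are exact. But a comparison sees at most two inputs, everything else
  being constant now, so the pattern of branches is a finite colouring of the neighbourhood given by
  conditions on pairs of coordinates. Such a colouring cannot separate singular from nonsingular matrices:
  through the generic point passes a plane of singular matrices, and Gallai's theorem (\<open>gallai\<close>) yields
  in it points \<open>a\<close> and \<open>a + t f j\<close> of one colour with \<open>t \<noteq> 0\<close>, where \<open>f j\<close> has the entry 1 in
  the top right corner and 0 on diagonal \<open>j\<close>. The matrix \<open>y\<close> obtained from \<open>a\<close> by adding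
  \<open>t\<close> to the corner entry alone agrees with one of these points in any two coordinates. Thus \<open>y\<close> has
  a run with the same branches and the same computed values, and it ends with the value 0, as it must
  for the singular matrices. But the determinant of \<open>y\<close> is, up to sign, \<open>t\<close> times a minor that
  is nonzero near the generic point (\<open>det_toeplitz_corner\<close>), so the relative error is 1.
\<close>

section \<open>Homothetic copies in finite colourings\<close>

definition monochromatic :: "('v \<Rightarrow> 'c) \<Rightarrow> 'v set \<Rightarrow> bool" where
  "monochromatic \<chi> A \<longleftrightarrow> (\<forall>x\<in>A. \<forall>y\<in>A. \<chi> x = \<chi> y)"

definition homothet :: "'v::real_vector \<times> nat \<Rightarrow> 'v \<Rightarrow> 'v" where
  "homothet h f = fst h + real (snd h) *\<^sub>R f"

definition gallai_family :: "'v::real_vector set \<Rightarrow> nat \<Rightarrow> ('v \<times> nat) set \<Rightarrow> bool" where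
  "gallai_family F r S \<longleftrightarrow> finite S \<and> (\<forall>h\<in>S. 0 < snd h) \<and>
     (\<forall>\<chi>::'v \<Rightarrow> nat. (\<forall>v. \<chi> v < r) \<longrightarrow> (\<exists>h\<in>S. monochromatic \<chi> (homothet h ` F)))"

text \<open>
  A partial success of the search for a monochromatic copy of \<^term>\<open>insert g F\<close>: for every colour in
  \<^term>\<open>C\<close> a copy of \<^term>\<open>F\<close> of that colour whose missing point, the image of \<^term>\<open>g\<close>, is
  the common focus \<^term>\<open>b\<close>.
\<close>

definition focused :: "'v::real_vector set \<Rightarrow> 'v \<Rightarrow> ('v \<times> nat) set \<Rightarrow> ('v \<Rightarrow> nat) \<Rightarrow> 'v \<Rightarrow> nat set \<Rightarrow> bool" where
  "focused F g S \<chi> b C \<longleftrightarrow> finite C \<and>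
     (\<forall>c\<in>C. \<exists>h\<in>S. homothet h g = b \<and> (\<forall>f\<in>F. \<chi> (homothet h f) = c))"

text \<open>
  Colour focusing. Every further focused colour costs one application of the hypothesis on \<^term>\<open>F\<close>
  to the colouring of points by the patterns they see in the finite window \<^term>\<open>W\<close>: it yields a
  homothet of \<^term>\<open>F\<close> at all points of which the old configuration recurs in the same colours.
\<close>

lemma focusing:
  fixes F :: "'v::real_vector set" and g :: 'v
  assumes F: "finite F" "F \<noteq> {}" and IH: "\<And>r. \<exists>S. gallai_family F r S"
  shows "\<exists>S W. finite S \<and> finite W \<and> (\<forall>h\<in>S. 0 < snd h \<and> homothet h ` insert g F \<subseteq> W) \<and>
     (\<forall>\<chi>::'v \<Rightarrow> nat. (\<forall>v. \<chi> v < r) \<longrightarrow>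
        (\<exists>h\<in>S. monochromatic \<chi> (homothet h ` insert g F)) \<or>
        (\<exists>b\<in>W. \<exists>C. card C = s \<and> focused F g S \<chi> b C))"
proof (induction s)
  case 0
  show ?case
    by (rule exI[of _ "{}"], rule exI[of _ "{0}"]) (auto simp: focused_def intro!: exI[of _ "{}"])
next
  case (Suc s)
  then obtain S W where fin: "finite S" "finite W"
    and S: "\<forall>h\<in>S. 0 < snd h \<and> homothet h ` insert g F \<subseteq> W"
    and SW: "\<forall>\<chi>::'v \<Rightarrow> nat. (\<forall>v. \<chi> v < r) \<longrightarrow>
        (\<exists>h\<in>S. monochromatic \<chi> (homothet h ` insert g F)) \<or>
        (\<exists>b\<in>W. \<exists>C. card C = s \<and> focused F g S \<chi> b C)"
    by (elim exE conjE)
  let ?Pat = "W \<rightarrow>\<^sub>E {..<r}"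
  have "finite ?Pat" using fin by (simp add: finite_PiE)
  then obtain enc :: "('v \<Rightarrow> nat) \<Rightarrow> nat" and r' where enc: "enc ` ?Pat = {..<r'}" "inj_on enc ?Pat"
    using finite_imp_inj_to_nat_seg[of ?Pat] by (auto simp: lessThan_def)
  obtain S' where S': "gallai_family F r' S'" using IH by blast
  have finS': "finite S'" using S' by (simp add: gallai_family_def)
  obtain f0 where f0: "f0 \<in> F" using F by blast
  define add where "add = (\<lambda>(k::'v \<times> nat) (h::'v \<times> nat). (fst k + fst h, snd k + snd h))"
  \<comment> \<open>\<open>T1\<close>: an old homothet dragged along the recurrence; \<open>T2\<close>: the recurrence of the old focus;
    \<open>T3\<close>: a copy of an old homothet inside one recurrence.\<close>
  define T1 where "T1 = (\<lambda>(k, h). add k h) ` (S' \<times> S)"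
  define T2 where "T2 = (\<lambda>(k, b). (fst k + b, snd k)) ` (S' \<times> W)"
  define T3 where "T3 = (\<lambda>(k, h). (homothet k f0 + fst h, snd h)) ` (S' \<times> S)"
  define S2 where "S2 = T1 \<union> T2 \<union> T3"
  define W2 where "W2 = (\<Union>h\<in>S2. homothet h ` insert g F)"
  have fin2: "finite S2" "finite W2"
    using fin finS' F(1) by (simp_all add: W2_def S2_def T1_def T2_def T3_def)
  have T1I: "add k h \<in> S2" if "k \<in> S'" "h \<in> S" for k h
    unfolding S2_def T1_def by (intro UnI1 image_eqI[of _ _ "(k, h)"]) (simp_all add: that)
  have T2I: "(fst k + b, snd k) \<in> S2" if "k \<in> S'" "b \<in> W" for k b
    unfolding S2_def T2_def by (intro UnI1 UnI2 image_eqI[of _ _ "(k, b)"]) (simp_all add: that)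
  have T3I: "(homothet k f0 + fst h, snd h) \<in> S2" if "k \<in> S'" "h \<in> S" for k h
    unfolding S2_def T3_def by (intro UnI2 image_eqI[of _ _ "(k, h)"]) (simp_all add: that)
  have posS: "0 < snd h" if "h \<in> S" for h using S that by blast
  have posS': "0 < snd k" if "k \<in> S'" for k using S' that by (simp add: gallai_family_def)
  have "0 < snd h" if "h \<in> S2" for h
    using that posS posS' by (fastforce simp: S2_def T1_def T2_def T3_def add_def)
  moreover have "homothet h ` insert g F \<subseteq> W2" if "h \<in> S2" for h
    using that unfolding W2_def by blast
  ultimately have pos: "\<forall>h\<in>S2. 0 < snd h \<and> homothet h ` insert g F \<subseteq> W2" by blast
  have hom_add: "homothet (add k h) f = homothet k f + homothet h f" for k h f
    by (simp add: homothet_def add_def algebra_simps)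
  have "(\<exists>h\<in>S2. monochromatic \<chi> (homothet h ` insert g F)) \<or>
        (\<exists>b\<in>W2. \<exists>C. card C = Suc s \<and> focused F g S2 \<chi> b C)"
    if \<chi>: "\<forall>v. \<chi> v < r" for \<chi> :: "'v \<Rightarrow> nat"
  proof -
    define pat where "pat = (\<lambda>v. restrict (\<lambda>w. \<chi> (v + w)) W)"
    have pat_in: "pat v \<in> ?Pat" for v using \<chi> by (simp add: pat_def)
    have lt: "\<forall>v. enc (pat v) < r'"
    proof
      fix v
      have "enc (pat v) \<in> enc ` ?Pat" by (rule imageI[OF pat_in])
      then show "enc (pat v) < r'" unfolding enc(1) by (rule lessThan_iff[THEN iffD1])
    qed
    have "\<forall>\<chi>::'v \<Rightarrow> nat. (\<forall>v. \<chi> v < r') \<longrightarrow> (\<exists>k\<in>S'. monochromatic \<chi> (homothet k ` F))"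
      using S' by (simp add: gallai_family_def)
    from mp[OF spec[OF this] lt]
    obtain k where k: "k \<in> S'" "monochromatic (\<lambda>v. enc (pat v)) (homothet k ` F)"
      by (rule bexE)
    have same: "\<chi> (homothet k f + w) = \<chi> (homothet k f0 + w)" if "f \<in> F" "w \<in> W" for f w
    proof -
      have "enc (pat (homothet k f)) = enc (pat (homothet k f0))"
        using k(2) that(1) f0 unfolding monochromatic_def by blast
      then have "pat (homothet k f) = pat (homothet k f0)"
        by (rule inj_onD[OF enc(2) _ pat_in pat_in])
      from fun_cong[OF this, of w] show ?thesis using that(2) by (simp add: pat_def)
    qed
    define \<chi>' where "\<chi>' = (\<lambda>w. \<chi> (homothet k f0 + w))"
    have hom3: "homothet (homothet k f0 + fst h, snd h) f = homothet k f0 + homothet h f" for h f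
      by (simp add: homothet_def algebra_simps)
    have lift: "\<exists>h\<in>S2. monochromatic \<chi> (homothet h ` insert g F)"
      if "h \<in> S" "monochromatic \<chi>' (homothet h ` insert g F)" for h
    proof (rule bexI[OF _ T3I[OF k(1) that(1)]])
      show "monochromatic \<chi> (homothet (homothet k f0 + fst h, snd h) ` insert g F)"
        using that(2) unfolding monochromatic_def ball_simps hom3 \<chi>'_def by blast
    qed
    have "\<forall>v. \<chi>' v < r" using \<chi> by (simp add: \<chi>'_def)
    from mp[OF spec[OF SW] this] show ?thesis
    proof (elim disjE bexE exE conjE)
      fix h assume "h \<in> S" "monochromatic \<chi>' (homothet h ` insert g F)"
      then show ?thesis using lift by blast
    next
      fix b C assume b: "b \<in> W" and C: "card C = s" and foc: "focused F g S \<chi>' b C"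
      define c0 where "c0 = \<chi>' b"
      show ?thesis
      proof (cases "c0 \<in> C")
        case True
        then obtain h where h: "h \<in> S" "homothet h g = b" "\<forall>f\<in>F. \<chi>' (homothet h f) = c0"
          using foc by (auto simp: focused_def)
        then have "monochromatic \<chi>' (homothet h ` insert g F)"
          unfolding monochromatic_def ball_simps c0_def by metis
        then show ?thesis using lift h(1) by blast
      next
        case False
        define b' where "b' = homothet k g + b"
        have finC: "finite C" using foc by (simp add: focused_def)
        have new: "(fst k + b, snd k) \<in> S2" by (rule T2I[OF k(1) b])
        have homnew: "homothet (fst k + b, snd k) f = homothet k f + b" for f
          by (simp add: homothet_def algebra_simps)
        have "\<exists>h\<in>S2. homothet h g = b' \<and> (\<forall>f\<in>F. \<chi> (homothet h f) = c)" if c: "c \<in> insert c0 C" for c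
        proof (cases "c = c0")
          case True
          then show ?thesis
            by (intro bexI[OF _ new]) (simp add: homnew b'_def same[OF _ b] c0_def \<chi>'_def)
        next
          case False
          with c foc obtain h where h: "h \<in> S" "homothet h g = b" "\<forall>f\<in>F. \<chi>' (homothet h f) = c"
            by (auto simp: focused_def)
          have "add k h \<in> S2" by (rule T1I[OF k(1) h(1)])
          moreover have "\<chi> (homothet (add k h) f) = c" if "f \<in> F" for f
          proof -
            have "homothet h f \<in> W" using S h(1) that by blast
            then show ?thesis using same[OF that] h(3) that by (simp add: hom_add \<chi>'_def)
          qed
          ultimately show ?thesis using h(2) by (intro bexI[of _ "add k h"]) (auto simp: hom_add b'_def)
        qed
        then have "focused F g S2 \<chi> b' (insert c0 C)" using finC by (simp add: focused_def)
        moreover have "b' \<in> W2"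
          using new by (auto simp: W2_def b'_def homnew[symmetric])
        ultimately show ?thesis using C False finC by (metis card_insert_disjoint)
      qed
    qed
  qed
  then show ?case using fin2 pos by blast
qed

text \<open>
  With one focused colour more than there are colours, the second alternative of focusing is
  impossible.
\<close>

lemma gallai_insert:
  fixes F :: "'v::real_vector set"
  assumes F: "finite F" "F \<noteq> {}" and IH: "\<And>r. \<exists>S. gallai_family F r S"
  shows "\<exists>S. gallai_family (insert g F) r S"
proof -
  obtain S W where S: "finite S" "\<forall>h\<in>S. 0 < snd h \<and> homothet h ` insert g F \<subseteq> W"
    and SW: "\<forall>\<chi>::'v \<Rightarrow> nat. (\<forall>v. \<chi> v < r) \<longrightarrow>
        (\<exists>h\<in>S. monochromatic \<chi> (homothet h ` insert g F)) \<or>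
        (\<exists>b\<in>W. \<exists>C. card C = Suc r \<and> focused F g S \<chi> b C)"
    using focusing[OF F IH, of g r "Suc r"] by (elim exE conjE)
  obtain f0 where f0: "f0 \<in> F" using F by blast
  have "\<exists>h\<in>S. monochromatic \<chi> (homothet h ` insert g F)" if \<chi>: "\<forall>v. \<chi> v < r" for \<chi> :: "'v \<Rightarrow> nat"
  proof (rule ccontr)
    assume "\<not> ?thesis"
    then obtain b C where C: "card C = Suc r" "focused F g S \<chi> b C" using SW \<chi> by blast
    then have "C \<subseteq> {..<r}" using f0 \<chi> unfolding focused_def by force
    then have "card C \<le> r" using card_mono[of "{..<r}" C] by simp
    then show False using C by simp
  qed
  then show ?thesis using S unfolding gallai_family_def by blast
qed

text \<open>
  Gallai's theorem in a compact form: finitely many homotheties suffice for all colourings with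
  \<^term>\<open>r\<close> colours. Finiteness is what later allows the configuration to be scaled into a small
  neighbourhood of a given point.
\<close>

theorem gallai:
  fixes F :: "'v::real_vector set"
  assumes "finite F"
  shows "\<exists>S. gallai_family F r S"
  using assms
proof (induction F arbitrary: r rule: finite_induct)
  case empty
  show ?case by (rule exI[of _ "{(0, 1)}"]) (simp add: gallai_family_def monochromatic_def)
next
  case (insert g F)
  show ?case
  proof (cases "F = {}")
    case True
    then show ?thesis
      by (intro exI[of _ "{(0, 1)}"]) (simp add: gallai_family_def monochromatic_def)
  next
    case False
    then show ?thesis using gallai_insert[OF insert(1) _ insert(3)] by blast
  qed
qed

section \<open>Functions of bounded degree on secant varieties\<close>

text \<open>
  A point of the \<^term>\<open>k\<close>-th secant variety of the cone over the monomial curve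
  \<^term>\<open>\<lambda>r i. r ^ e i\<close>.
\<close>

definition secant_point :: "('i \<Rightarrow> nat) \<Rightarrow> nat \<Rightarrow> (nat \<Rightarrow> complex) \<Rightarrow> (nat \<Rightarrow> complex) \<Rightarrow> 'i \<Rightarrow> complex" where
  "secant_point e k \<alpha> \<rho> i = (\<Sum>l<k. \<alpha> l * \<rho> l ^ e i)"

text \<open>
  A function has degree at most \<^term>\<open>d\<close> if all its differences of order \<open>d + 1\<close> vanish. This
  form of the degree is the one that the induction over secant varieties consumes.
\<close>

fun degree_le :: "nat \<Rightarrow> (('i \<Rightarrow> complex) \<Rightarrow> complex) \<Rightarrow> bool" where
  "degree_le 0 f \<longleftrightarrow> (\<forall>x y. f x = f y)"
| "degree_le (Suc d) f \<longleftrightarrow> (\<forall>c. degree_le d (\<lambda>x. f (\<lambda>i. x i + c i) - f x))"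

lemma degree_le_const [simp]: "degree_le d (\<lambda>x. c)"
  by (induction d arbitrary: c) simp_all

lemma degree_le_0E:
  assumes "degree_le 0 f"
  obtains c where "f = (\<lambda>x. c)"
proof
  show "f = (\<lambda>x. f (\<lambda>_. 0))" using assms unfolding degree_le.simps by blast
qed

lemma degree_le_Suc: "degree_le d f \<Longrightarrow> degree_le (Suc d) f"
proof (induction d arbitrary: f)
  case 0
  have "(\<lambda>x. f (\<lambda>i. x i + c i) - f x) = (\<lambda>x. 0)" for c
    using 0 by auto
  then show ?case by (simp del: degree_le.simps(1))
next
  case (Suc d)
  show ?case
    unfolding degree_le.simps(2)[of "Suc d"]
  proof
    fix c
    have "degree_le d (\<lambda>x. f (\<lambda>i. x i + c i) - f x)" using Suc.prems by simp
    then show "degree_le (Suc d) (\<lambda>x. f (\<lambda>i. x i + c i) - f x)" by (rule Suc.IH)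
  qed
qed

lemma degree_le_mono: "a \<le> b \<Longrightarrow> degree_le a f \<Longrightarrow> degree_le b f"
  by (induction b rule: dec_induct) (blast intro: degree_le_Suc)+

lemma degree_le_translate: "degree_le d f \<Longrightarrow> degree_le d (\<lambda>x. f (\<lambda>i. x i + c i))"
proof (induction d arbitrary: f)
  case 0
  then show ?case by simp
next
  case (Suc d)
  show ?case unfolding degree_le.simps
  proof
    fix b
    have "degree_le d (\<lambda>x. f (\<lambda>i. x i + b i) - f x)" using Suc.prems by simp
    from Suc.IH[OF this]
    show "degree_le d (\<lambda>x. f (\<lambda>i. x i + b i + c i) - f (\<lambda>i. x i + c i))"
      by (simp add: add_ac)
  qed
qed

lemma degree_le_add: "degree_le d f \<Longrightarrow> degree_le d g \<Longrightarrow> degree_le d (\<lambda>x. f x + g x)"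
proof (induction d arbitrary: f g)
  case 0
  then show ?case unfolding degree_le.simps by metis
next
  case (Suc d)
  show ?case unfolding degree_le.simps
  proof
    fix c
    have "degree_le d (\<lambda>x. (f (\<lambda>i. x i + c i) - f x) + (g (\<lambda>i. x i + c i) - g x))"
      by (rule Suc.IH) (use Suc.prems in simp_all)
    then show "degree_le d (\<lambda>x. f (\<lambda>i. x i + c i) + g (\<lambda>i. x i + c i) - (f x + g x))"
      by (simp add: algebra_simps)
  qed
qed

lemma degree_le_cmult: "degree_le d f \<Longrightarrow> degree_le d (\<lambda>x. c * f x)"
proof (induction d arbitrary: f)
  case 0
  then show ?case unfolding degree_le.simps by metis
next
  case (Suc d)
  show ?case unfolding degree_le.simps
    using Suc.IH Suc.prems by (simp flip: right_diff_distrib)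
qed

lemma degree_le_mult:
  "degree_le a f \<Longrightarrow> degree_le b g \<Longrightarrow> degree_le (a + b) (\<lambda>x. f x * g x)"
proof (induction "a + b" arbitrary: a b f g)
  case 0
  then have ab: "a = 0" "b = 0" by simp_all
  obtain c c' where "f = (\<lambda>x. c)" "g = (\<lambda>x. c')"
    using 0(2,3) degree_le_0E unfolding ab by metis
  then show ?case by simp
next
  case (Suc n)
  consider "a = 0" | "b = 0" | a' b' where "a = Suc a'" "b = Suc b'"
    by (metis not0_implies_Suc)
  then show ?case
  proof cases
    case 1
    then obtain c where "f = (\<lambda>x. c)" using Suc.prems(1) degree_le_0E by blast
    then show ?thesis using degree_le_cmult[OF Suc.prems(2)] 1 by simp
  next
    case 2
    then obtain c where "g = (\<lambda>x. c)" using Suc.prems(2) degree_le_0E by blast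
    then show ?thesis using degree_le_cmult[OF Suc.prems(1), of c] 2 by (simp add: mult.commute)
  next
    case 3
    have n: "a + b' = n" "a' + b = n" using Suc.hyps(2) 3 by simp_all
    have "degree_le n (\<lambda>x. f (\<lambda>i. x i + c i) * g (\<lambda>i. x i + c i) - f x * g x)" for c
    proof -
      have "degree_le b' (\<lambda>x. g (\<lambda>i. x i + c i) - g x)" "degree_le a' (\<lambda>x. f (\<lambda>i. x i + c i) - f x)"
        using Suc.prems unfolding 3 degree_le.simps by blast+
      then have "degree_le n (\<lambda>x. f (\<lambda>i. x i + c i) * (g (\<lambda>i. x i + c i) - g x))"
        "degree_le n (\<lambda>x. (f (\<lambda>i. x i + c i) - f x) * g x)"
        using Suc.hyps(1)[OF n(1)[symmetric] degree_le_translate[OF Suc.prems(1)]]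
          Suc.hyps(1)[OF n(2)[symmetric] _ Suc.prems(2)] n by simp_all
      from degree_le_add[OF this] show ?thesis by (simp add: algebra_simps)
    qed
    then show ?thesis unfolding Suc.hyps(2)[symmetric] degree_le.simps by blast
  qed
qed

lemma degree_le_power: "degree_le a f \<Longrightarrow> degree_le (a * n) (\<lambda>x. f x ^ n)"
  by (induction n) (simp_all add: degree_le_mult del: degree_le.simps)

lemma degree_le_prod:
  "finite A \<Longrightarrow> (\<And>j. j \<in> A \<Longrightarrow> degree_le (d j) (f j)) \<Longrightarrow> degree_le (\<Sum>j\<in>A. d j) (\<lambda>x. \<Prod>j\<in>A. f j x)"
  by (induction A rule: finite_induct) (simp_all add: degree_le_mult del: degree_le.simps)

lemma degree_le_sum:
  "(\<And>j. j \<in> A \<Longrightarrow> degree_le d (f j)) \<Longrightarrow> degree_le d (\<lambda>x. \<Sum>j\<in>A. f j x)"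
  by (induction A rule: infinite_finite_induct) (simp_all add: degree_le_add del: degree_le.simps)

lemma degree_le_coordinate: "degree_le 1 (\<lambda>x. x i)"
  by simp

lemma degree_le_mpoly_eval:
  assumes "\<And>v. v \<in> mvars q \<Longrightarrow> degree_le 1 (g v)" "total_degree q \<le> d"
  shows "degree_le d (\<lambda>x. mpoly_eval (\<lambda>v. g v x) q)"
  unfolding mpoly_eval_def
proof (intro degree_le_sum degree_le_cmult)
  fix m assume m: "m \<in> Poly_Mapping.keys q"
  have "degree_le (\<Sum>v\<in>Poly_Mapping.keys m. 1 * Poly_Mapping.lookup m v)
     (\<lambda>x. \<Prod>v\<in>Poly_Mapping.keys m. g v x ^ Poly_Mapping.lookup m v)"
    using m by (intro degree_le_prod degree_le_power assms(1)) (auto simp: mvars_def)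
  moreover have "(\<Sum>v\<in>Poly_Mapping.keys m. 1 * Poly_Mapping.lookup m v) \<le> total_degree q"
    using m by (auto simp: total_degree_def monomial_degree_def intro!: Max_ge)
  ultimately show "degree_le d (\<lambda>x. \<Prod>v\<in>Poly_Mapping.keys m. g v x ^ Poly_Mapping.lookup m v)"
    using assms(2) by (meson degree_le_mono order_trans)
qed

lemma degree_le_det:
  assumes "\<And>i j. i < n \<Longrightarrow> j < n \<Longrightarrow> degree_le 1 (g i j)"
  shows "degree_le n (\<lambda>x. det (mat n n (\<lambda>(i, j). g i j x)))"
proof -
  have "degree_le n (\<lambda>x. \<Sum>p\<in>{p. p permutes {0..<n}}. signof p * (\<Prod>i\<in>{0..<n}. g i (p i) x))"
  proof (intro degree_le_sum degree_le_cmult)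
    fix p assume p: "p \<in> {p. p permutes {0..<n}}"
    have "degree_le (\<Sum>i\<in>{0..<n}. 1) (\<lambda>x. \<Prod>i\<in>{0..<n}. g i (p i) x)"
      using p permutes_in_image[of p "{0..<n}"] by (intro degree_le_prod assms) auto
    then show "degree_le n (\<lambda>x. \<Prod>i = 0..<n. g i (p i) x)" by simp
  qed
  moreover have "det (mat n n (\<lambda>(i, j). g i j x)) =
      (\<Sum>p\<in>{p. p permutes {0..<n}}. signof p * (\<Prod>i\<in>{0..<n}. g i (p i) x))" for x
    by (subst det_def'[of _ n]) (auto intro!: sum.cong prod.cong simp: permutes_in_image)
  ultimately show ?thesis by simp
qed

text \<open>
  Orthogonality of the characters of a cyclic group, needed to invert the discrete Fourier transform.
\<close>

lemma sum_root_of_unity_powers: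
  assumes "a < N" "b < N"
  defines "\<omega> \<equiv> cis (2 * pi / real N)"
  shows "(\<Sum>l<N. cnj (\<omega> ^ l) ^ a * (\<omega> ^ l) ^ b) = (if a = b then of_nat N else 0)"
proof -
  have N: "N > 0" using assms by simp
  define z where "z = cnj \<omega> ^ a * \<omega> ^ b"
  have terms: "cnj (\<omega> ^ l) ^ a * (\<omega> ^ l) ^ b = z ^ l" for l
    by (simp add: z_def power_mult_distrib mult.commute flip: power_mult)
  have inv: "cnj \<omega> * \<omega> = 1" by (simp add: \<omega>_def cis_cnj cis_mult)
  have pw: "\<omega> ^ k = cis (2 * pi * real k / real N)" for k
    by (simp add: \<omega>_def DeMoivre mult_ac)
  have \<omega>N: "\<omega> ^ N = 1" using N by (simp add: pw)
  have zN: "z ^ N = 1"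
  proof -
    have "z ^ N = cnj (\<omega> ^ N) ^ a * (\<omega> ^ N) ^ b" by (rule terms[symmetric])
    then show ?thesis by (simp add: \<omega>N)
  qed
  show ?thesis
  proof (cases "a = b")
    case True
    then have "z = 1" by (simp add: z_def inv flip: power_mult_distrib)
    then show ?thesis unfolding terms using True by simp
  next
    case False
    have "z \<noteq> 1"
    proof
      assume "z = 1"
      then have "\<omega> ^ a = \<omega> ^ a * (cnj \<omega> ^ a * \<omega> ^ b)" by (simp add: z_def)
      also have "\<dots> = (cnj \<omega> * \<omega>) ^ a * \<omega> ^ b" by (simp add: power_mult_distrib mult_ac)
      finally have "\<omega> ^ a = \<omega> ^ b" by (simp add: inv)
      moreover have "inj_on (\<lambda>k. cis (2 * pi * real k / real N)) {..<N}"
        using bij_betw_roots_unity[OF N] by (simp add: bij_betw_def)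
      ultimately have "a = b" using assms(1,2) by (auto simp: inj_on_def pw)
      then show False using False by simp
    qed
    then show ?thesis unfolding terms using zN by (simp add: sum_gp_strict False)
  qed
qed

text \<open>
  The curve spans the whole space: the points with roots of unity as parameters are the columns of
  a Fourier matrix, and the coefficients are found by the inverse transform.
\<close>

lemma secant_point_surj:
  fixes e :: "'i \<Rightarrow> nat"
  assumes "finite I" "inj_on e I"
  shows "\<exists>N \<alpha> \<rho>. \<forall>i\<in>I. x i = secant_point e N \<alpha> \<rho> i"
proof -
  obtain N where N: "\<And>i. i \<in> I \<Longrightarrow> e i < N"
    using finite_nat_set_iff_bounded[of "e ` I"] assms(1) by auto
  define \<omega> where "\<omega> = cis (2 * pi / real N)"
  define \<alpha> where "\<alpha> l = (\<Sum>i\<in>I. x i * cnj (\<omega> ^ l) ^ e i) / of_nat N" for l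
  have "secant_point e N \<alpha> (\<lambda>l. \<omega> ^ l) j = x j" if j: "j \<in> I" for j
  proof -
    have "N > 0" using N[OF j] by simp
    have "secant_point e N \<alpha> (\<lambda>l. \<omega> ^ l) j =
        (\<Sum>l<N. \<Sum>i\<in>I. x i * (cnj (\<omega> ^ l) ^ e i * (\<omega> ^ l) ^ e j)) / of_nat N"
      by (simp add: secant_point_def \<alpha>_def sum_distrib_left sum_distrib_right sum_divide_distrib mult_ac)
    also have "\<dots> = (\<Sum>i\<in>I. x i * (\<Sum>l<N. cnj (\<omega> ^ l) ^ e i * (\<omega> ^ l) ^ e j)) / of_nat N"
      by (subst sum.swap) (simp add: sum_distrib_left)
    also have "\<dots> = (\<Sum>i\<in>I. x i * (if e i = e j then of_nat N else 0)) / of_nat N"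
      unfolding \<omega>_def by (intro arg_cong2[of _ _ _ _ "(/)"] arg_cong2[of _ _ _ _ "(*)"] sum.cong refl)
        (rule sum_root_of_unity_powers[OF N N[OF j]])
    also have "(\<Sum>i\<in>I. x i * (if e i = e j then of_nat N else 0)) = (\<Sum>i\<in>I. if i = j then x j * of_nat N else 0)"
      using assms(2) j by (intro sum.cong) (auto simp: inj_on_eq_iff)
    finally show ?thesis using assms(1) j \<open>N > 0\<close> by simp
  qed
  then show ?thesis by (metis)
qed

text \<open>
  A nonzero polynomial vanishing on the \<^term>\<open>k\<close>-th secant variety has degree greater than \<^term>\<open>k\<close>.
  Differencing by a multiple of a curve point lowers both the degree and the order of the secant
  variety on which the function vanishes. By induction every such difference is zero, so the function is
  invariant under translation by the span of the curve, which is everything.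
\<close>

lemma vanishes_on_secants_imp_zero:
  fixes e :: "'i \<Rightarrow> nat"
  assumes I: "finite I" "inj_on e I"
    and dep: "\<And>x y. (\<And>i. i \<in> I \<Longrightarrow> x i = y i) \<Longrightarrow> f x = f y"
    and "degree_le d f" "d \<le> k"
    and "\<And>\<alpha> \<rho>. f (secant_point e k \<alpha> \<rho>) = 0"
  shows "f x = 0"
  using dep assms(4-6)
proof (induction d arbitrary: f k x)
  case 0
  have "f x = f (secant_point e k (\<lambda>_. 0) (\<lambda>_. 0))"
    using 0(2) unfolding degree_le.simps by blast
  then show ?case unfolding 0(4) .
next
  case (Suc d)
  obtain k' where k: "k = Suc k'" using Suc.prems(3) by (cases k) auto
  have inv: "f (\<lambda>i. x i + a * r ^ e i) = f x" for x a r
  proof -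
    define h where "h = (\<lambda>x. f (\<lambda>i. x i + a * r ^ e i) - f x)"
    have "h x = 0"
    proof (rule Suc.IH[where f = h and k = k'])
      show "h x = h y" if "\<And>i. i \<in> I \<Longrightarrow> x i = y i" for x y
      proof -
        have "f x = f y" "f (\<lambda>i. x i + a * r ^ e i) = f (\<lambda>i. y i + a * r ^ e i)"
          using that by (auto intro!: Suc.prems(1))
        then show ?thesis by (simp add: h_def)
      qed
      show "degree_le d h" using Suc.prems(2) by (simp add: h_def)
      show "d \<le> k'" using Suc.prems(3) k by simp
      show "h (secant_point e k' \<alpha> \<rho>) = 0" for \<alpha> \<rho>
      proof -
        have ext: "(\<lambda>i. secant_point e k' \<alpha> \<rho> i + b * r ^ e i) =
            secant_point e k (\<alpha>(k' := b)) (\<rho>(k' := r))" for b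
          by (auto simp: secant_point_def k)
        have "f (\<lambda>i. secant_point e k' \<alpha> \<rho> i + a * r ^ e i) = 0"
          unfolding ext by (rule Suc.prems(4))
        moreover have "f (secant_point e k' \<alpha> \<rho>) = 0"
          using Suc.prems(4) ext[of 0] by simp
        ultimately show ?thesis by (simp add: h_def)
      qed
    qed
    then show ?thesis by (simp add: h_def)
  qed
  have "f (secant_point e N \<alpha> \<rho>) = f (\<lambda>_. 0)" for N \<alpha> \<rho>
  proof (induction N)
    case 0
    show ?case by (rule Suc.prems(1)) (simp add: secant_point_def)
  next
    case (Suc N)
    have "secant_point e (Suc N) \<alpha> \<rho> = (\<lambda>i. secant_point e N \<alpha> \<rho> i + \<alpha> N * \<rho> N ^ e i)"
      by (auto simp: secant_point_def)
    then show ?case using Suc.IH inv by simp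
  qed
  moreover obtain N \<alpha> \<rho> where "\<forall>i\<in>I. x i = secant_point e N \<alpha> \<rho> i"
    using secant_point_surj[OF I] by blast
  then have "f x = f (secant_point e N \<alpha> \<rho>)" by (intro Suc.prems(1)) simp
  moreover have "f (secant_point e k \<alpha> \<rho>) = 0" by (rule Suc.prems(4))
  ultimately show ?case by metis
qed

section \<open>Evaluation of multivariate polynomials\<close>

lemma mpoly_eval_superset:
  assumes "finite A" "Poly_Mapping.keys p \<subseteq> A"
  shows "mpoly_eval x p = (\<Sum>m\<in>A. Poly_Mapping.lookup p m *
     (\<Prod>v\<in>Poly_Mapping.keys m. x v ^ Poly_Mapping.lookup m v))"
  unfolding mpoly_eval_def using assms by (intro sum.mono_neutral_left) (auto simp: in_keys_iff)

definition monomial_eval :: "('v \<Rightarrow> complex) \<Rightarrow> ('v \<Rightarrow>\<^sub>0 nat) \<Rightarrow> complex" where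
  "monomial_eval x m = (\<Prod>v\<in>Poly_Mapping.keys m. x v ^ Poly_Mapping.lookup m v)"

lemma monomial_eval_superset:
  assumes "finite A" "Poly_Mapping.keys m \<subseteq> A"
  shows "monomial_eval x m = (\<Prod>v\<in>A. x v ^ Poly_Mapping.lookup m v)"
  unfolding monomial_eval_def using assms by (intro prod.mono_neutral_left) (auto simp: in_keys_iff)

lemma monomial_eval_add: "monomial_eval x (m + n) = monomial_eval x m * monomial_eval x n"
proof -
  let ?A = "Poly_Mapping.keys m \<union> Poly_Mapping.keys n"
  have "Poly_Mapping.keys (m + n) \<subseteq> ?A" by (rule Poly_Mapping.keys_add)
  then show ?thesis
    by (simp add: monomial_eval_superset[of ?A] lookup_add power_add prod.distrib)
qed

lemma mpoly_eval_add: "mpoly_eval x (p + q) = mpoly_eval x p + mpoly_eval x q"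
proof -
  let ?A = "Poly_Mapping.keys p \<union> Poly_Mapping.keys q"
  have "Poly_Mapping.keys (p + q) \<subseteq> ?A" by (rule Poly_Mapping.keys_add)
  then show ?thesis
    by (simp add: mpoly_eval_superset[of ?A] lookup_add distrib_right sum.distrib)
qed

lemma mpoly_eval_single: "mpoly_eval x (Poly_Mapping.single m c) = c * monomial_eval x m"
  by (simp add: mpoly_eval_def monomial_eval_def)

lemma update_eq_add_single:
  assumes "a \<notin> Poly_Mapping.keys f"
  shows "Poly_Mapping.update a b f = f + Poly_Mapping.single a b"
  using assms by (intro poly_mapping_eqI) (auto simp: lookup_update lookup_add lookup_single in_keys_iff when_def)

lemma mpoly_induct [case_names zero add_single]:
  assumes "P 0" "\<And>p m c. P p \<Longrightarrow> P (p + Poly_Mapping.single m c)"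
  shows "P (p::'v mpoly)"
  using assms by (induction p rule: Poly_Mapping.update_induct) (simp_all add: update_eq_add_single)

lemma mpoly_eval_0: "mpoly_eval x 0 = 0"
  by (simp add: mpoly_eval_def)

lemma mpoly_eval_mult: "mpoly_eval x (p * q) = mpoly_eval x p * mpoly_eval x q"
proof (induction p rule: mpoly_induct)
  case zero
  show ?case by (simp add: mpoly_eval_0)
next
  case (add_single p m c)
  have "mpoly_eval x (Poly_Mapping.single m c * q) = c * monomial_eval x m * mpoly_eval x q"
    by (induction q rule: mpoly_induct)
      (simp_all add: mpoly_eval_0 distrib_left mpoly_eval_add mult_single mpoly_eval_single
        monomial_eval_add)
  then show ?case
    by (simp add: distrib_right mpoly_eval_add add_single mpoly_eval_single)
qed

interpretation mpoly_eval: comm_ring_hom "mpoly_eval x" for x :: "'v \<Rightarrow> complex"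
proof
  have "(1::'v mpoly) = Poly_Mapping.single 0 1" by simp
  then show "mpoly_eval x 1 = 1" by (metis mpoly_eval_single monomial_eval_def keys_zero prod.empty mult_1)
qed (simp_all add: mpoly_eval_add mpoly_eval_mult mpoly_eval_0)

lemma mpoly_eval_mvar: "mpoly_eval x (mvar v) = x v"
  by (simp add: mvar_def mpoly_eval_single monomial_eval_def)

lemma mpoly_eval_cong:
  assumes "\<And>v. v \<in> mvars p \<Longrightarrow> x v = y v"
  shows "mpoly_eval x p = mpoly_eval y p"
  unfolding mpoly_eval_def
proof (intro sum.cong refl arg_cong2[of _ _ _ _ "(*)"] prod.cong)
  fix m v assume "m \<in> Poly_Mapping.keys p" "v \<in> Poly_Mapping.keys m"
  then have "v \<in> mvars p" by (auto simp: mvars_def)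
  then show "x v ^ Poly_Mapping.lookup m v = y v ^ Poly_Mapping.lookup m v" using assms by simp
qed

section \<open>Univariate restrictions of polynomials\<close>

definition polynomial_fun :: "(complex \<Rightarrow> complex) \<Rightarrow> bool" where
  "polynomial_fun f \<longleftrightarrow> (\<exists>p. \<forall>t. f t = poly p t)"

lemma polynomial_fun_const [simp]: "polynomial_fun (\<lambda>t. c)"
  unfolding polynomial_fun_def by (rule exI[of _ "[:c:]"]) simp

lemma polynomial_fun_ident [simp]: "polynomial_fun (\<lambda>t. t)"
  unfolding polynomial_fun_def by (rule exI[of _ "[:0, 1:]"]) simp

lemma polynomial_fun_add [intro]:
  "polynomial_fun f \<Longrightarrow> polynomial_fun g \<Longrightarrow> polynomial_fun (\<lambda>t. f t + g t)"
  unfolding polynomial_fun_def by (metis poly_add)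

lemma polynomial_fun_mult [intro]:
  "polynomial_fun f \<Longrightarrow> polynomial_fun g \<Longrightarrow> polynomial_fun (\<lambda>t. f t * g t)"
  unfolding polynomial_fun_def by (metis poly_mult)

lemma polynomial_fun_diff [intro]:
  "polynomial_fun f \<Longrightarrow> polynomial_fun g \<Longrightarrow> polynomial_fun (\<lambda>t. f t - g t)"
  unfolding polynomial_fun_def by (metis poly_diff)

lemma polynomial_fun_power [intro]: "polynomial_fun f \<Longrightarrow> polynomial_fun (\<lambda>t. f t ^ n)"
  by (induction n) auto

lemma polynomial_fun_sum:
  "(\<And>j. j \<in> A \<Longrightarrow> polynomial_fun (f j)) \<Longrightarrow> polynomial_fun (\<lambda>t. \<Sum>j\<in>A. f j t)"
  by (induction A rule: infinite_finite_induct) auto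

lemma polynomial_fun_prod:
  "(\<And>j. j \<in> A \<Longrightarrow> polynomial_fun (f j)) \<Longrightarrow> polynomial_fun (\<lambda>t. \<Prod>j\<in>A. f j t)"
  by (induction A rule: infinite_finite_induct) auto

lemma polynomial_fun_mpoly_eval:
  "(\<And>v. polynomial_fun (\<lambda>t. g t v)) \<Longrightarrow> polynomial_fun (\<lambda>t. mpoly_eval (g t) q)"
  unfolding mpoly_eval_def
  by (intro polynomial_fun_sum polynomial_fun_mult polynomial_fun_prod polynomial_fun_power) simp_all

lemma polynomial_fun_secant_point:
  assumes "\<And>l. polynomial_fun (\<lambda>t. \<alpha> t l)" "\<And>l. polynomial_fun (\<lambda>t. \<rho> t l)"
  shows "polynomial_fun (\<lambda>t. secant_point e k (\<alpha> t) (\<rho> t) i)"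
  unfolding secant_point_def
  by (intro polynomial_fun_sum polynomial_fun_mult polynomial_fun_power assms)

lemma polynomial_fun_det:
  assumes "\<And>i j. i < n \<Longrightarrow> j < n \<Longrightarrow> polynomial_fun (\<lambda>t. g i j t)"
  shows "polynomial_fun (\<lambda>t. det (mat n n (\<lambda>(i, j). g i j t)))"
proof -
  have "polynomial_fun (\<lambda>t. \<Sum>p\<in>{p. p permutes {0..<n}}. signof p * (\<Prod>i\<in>{0..<n}. g i (p i) t))"
    by (intro polynomial_fun_sum polynomial_fun_mult polynomial_fun_prod assms)
       (auto simp: permutes_in_image)
  moreover have "det (mat n n (\<lambda>(i, j). g i j t)) =
      (\<Sum>p\<in>{p. p permutes {0..<n}}. signof p * (\<Prod>i\<in>{0..<n}. g i (p i) t))" for t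
    by (subst det_def'[of _ n]) (auto intro!: sum.cong prod.cong simp: permutes_in_image)
  ultimately show ?thesis by simp
qed

lemma polynomial_fun_tendsto:
  assumes "polynomial_fun f"
  shows "(f \<longlongrightarrow> f a) (at a)"
proof -
  obtain p where "f = poly p" using assms unfolding polynomial_fun_def by blast
  then show ?thesis by (simp add: poly_isCont flip: isCont_def)
qed

lemma polynomial_fun_eventually_nonzero:
  assumes "polynomial_fun f" "f b \<noteq> 0"
  shows "eventually (\<lambda>t. f t \<noteq> 0) (at a)"
proof -
  obtain p where p: "f = poly p" using assms unfolding polynomial_fun_def by blast
  then have "p \<noteq> 0" using assms(2) by auto
  then have "finite {t. poly p t = 0}" by (rule poly_roots_finite)
  then have "eventually (\<lambda>t. \<forall>r\<in>{t. poly p t = 0}. t \<noteq> r) (at a)"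
    by (intro eventually_ball_finite) (auto intro: eventually_neq_at_within)
  then show ?thesis by (rule eventually_mono) (auto simp: p)
qed

text \<open>
  Being polynomial on every line is all that is needed of a polynomial in several variables to find
  common points where several of them do not vanish.
\<close>

definition polynomial_on_lines :: "(('i \<Rightarrow> complex) \<Rightarrow> complex) \<Rightarrow> bool" where
  "polynomial_on_lines f \<longleftrightarrow> (\<forall>a b. polynomial_fun (\<lambda>t. f (\<lambda>i. a i + t * b i)))"

text \<open>
  On the line joining two points, each function that is nonzero at one of them is nonzero at all but
  finitely many points.
\<close>

lemma common_nonzero:
  assumes "finite H" "\<And>h. h \<in> H \<Longrightarrow> polynomial_on_lines h" "\<And>h. h \<in> H \<Longrightarrow> \<exists>a. h a \<noteq> 0"
  shows "\<exists>a. \<forall>h\<in>H. h a \<noteq> 0"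
  using assms
proof (induction H rule: finite_induct)
  case empty
  show ?case by simp
next
  case (insert g H)
  then obtain a where a: "\<forall>h\<in>H. h a \<noteq> 0" by blast
  obtain b where b: "g b \<noteq> 0" using insert.prems(2) by blast
  define line where "line t = (\<lambda>i. a i + t * (b i - a i))" for t
  have poly: "polynomial_fun (\<lambda>t. h (line t))" if "h \<in> insert g H" for h
    using insert.prems(1)[OF that, unfolded polynomial_on_lines_def, THEN spec, of a, THEN spec,
      of "\<lambda>i. b i - a i"] unfolding line_def .
  have ends: "line 0 = a" "line 1 = b" by (simp_all add: line_def)
  have "eventually (\<lambda>t. h (line t) \<noteq> 0) (at 0)" if "h \<in> insert g H" for h
  proof (cases "h = g")
    case True
    then show ?thesis using polynomial_fun_eventually_nonzero[OF poly[OF that], of 1] b ends by simp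
  next
    case False
    then show ?thesis using polynomial_fun_eventually_nonzero[OF poly[OF that], of 0] a ends that by simp
  qed
  then have "eventually (\<lambda>t. \<forall>h\<in>insert g H. h (line t) \<noteq> 0) (at 0)"
    using insert.hyps(1) by (intro eventually_ball_finite) auto
  then obtain t where "\<forall>h\<in>insert g H. h (line t) \<noteq> 0"
    using eventually_happens'[OF at_neq_bot] by blast
  then show ?case by blast
qed

section \<open>Singular Toeplitz matrices\<close>

definition toeplitz :: "nat \<Rightarrow> (int \<Rightarrow> complex) \<Rightarrow> complex mat" where
  "toeplitz n x = mat n n (\<lambda>(i, j). x (int j - int i))"

lemma toeplitz_carrier [simp]: "toeplitz n x \<in> carrier_mat n n"
  by (simp add: toeplitz_def)

lemma mpoly_eval_toeplitz_det: "mpoly_eval x (toeplitz_det n) = det (toeplitz n x)"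
proof -
  have "map_mat (mpoly_eval x) (toeplitz_matrix n) = toeplitz n x"
    by (rule eq_matI) (auto simp: toeplitz_matrix_def toeplitz_def mpoly_eval_mvar)
  then show ?thesis unfolding toeplitz_det_def by (simp flip: mpoly_eval.hom_det)
qed

lemma toeplitz_cong:
  assumes "\<And>k. k \<in> toeplitz_indices n \<Longrightarrow> x k = y k"
  shows "toeplitz n x = toeplitz n y"
  unfolding toeplitz_def by (rule cong_mat) (auto intro!: assms simp: toeplitz_indices_def)

text \<open>
  The cofactor, up to sign, of the top right entry. Since that entry occurs only once in the matrix,
  the determinant is an affine function of it with this slope.
\<close>

definition corner_minor :: "nat \<Rightarrow> (int \<Rightarrow> complex) \<Rightarrow> complex" where
  "corner_minor n x = det (toeplitz (n - 1) (\<lambda>k. x (k - 1)))"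

lemma det_toeplitz_corner:
  assumes "n \<ge> 1"
  shows "det (toeplitz n (x(int n - 1 := x (int n - 1) + c))) =
    det (toeplitz n x) + (-1) ^ (n - 1) * c * corner_minor n x"
proof -
  define y where "y = x(int n - 1 := x (int n - 1) + c)"
  have del: "mat_delete (toeplitz n z) 0 (n - 1) = toeplitz (n - 1) (\<lambda>k. z (k - 1))" for z
    by (rule eq_matI) (auto simp: mat_delete_def toeplitz_def algebra_simps)
  have det_y: "det (toeplitz n y) = (\<Sum>j<n. toeplitz n y $$ (0, j) * cofactor (toeplitz n y) 0 j)"
    using assms by (intro laplace_expansion_row) auto
  have "toeplitz n y $$ (0, j) * cofactor (toeplitz n y) 0 j =
      toeplitz n x $$ (0, j) * cofactor (toeplitz n x) 0 j + (if j = n - 1 then (-1) ^ (n - 1) * c * corner_minor n x else 0)"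
    if "j < n" for j
  proof -
    have "mat_delete (toeplitz n y) 0 j = mat_delete (toeplitz n x) 0 j"
      by (rule eq_matI) (auto simp: mat_delete_def toeplitz_def y_def)
    then have cof: "cofactor (toeplitz n y) 0 j = cofactor (toeplitz n x) 0 j"
      by (simp add: cofactor_def)
    show ?thesis
    proof (cases "j = n - 1")
      case True
      have "toeplitz n y $$ (0, j) = toeplitz n x $$ (0, j) + c"
        using that True assms by (auto simp: toeplitz_def y_def of_nat_diff)
      then show ?thesis using cof True
        by (simp add: cofactor_def del corner_minor_def algebra_simps del: One_nat_def)
    next
      case False
      then have "toeplitz n y $$ (0, j) = toeplitz n x $$ (0, j)"
        using that by (auto simp: toeplitz_def y_def)
      then show ?thesis using cof False by simp
    qed
  qed
  then have "det (toeplitz n y) = (\<Sum>j<n. toeplitz n x $$ (0, j) * cofactor (toeplitz n x) 0 j)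
     + (\<Sum>j<n. if j = n - 1 then (-1) ^ (n - 1) * c * corner_minor n x else 0)"
    unfolding det_y by (simp add: sum.distrib)
  also have "(\<Sum>j<n. toeplitz n x $$ (0, j) * cofactor (toeplitz n x) 0 j) = det (toeplitz n x)"
    using assms by (intro laplace_expansion_row[symmetric]) auto
  finally have "det (toeplitz n y) = det (toeplitz n x) + (-1) ^ (n - 1) * c * corner_minor n x"
    using assms by simp
  then show ?thesis unfolding y_def .
qed

text \<open>
  The exponent belonging to a diagonal; the diagonal in the bottom left corner gets the exponent 0.
\<close>

definition shift :: "nat \<Rightarrow> int \<Rightarrow> nat" where
  "shift n k = nat (k + int n - 1)"

text \<open>
  On the diagonals put the exponential sum \<open>\<Sum>l. \<alpha> l * \<rho> l ^ k\<close> with \<open>n - 1\<close> terms. The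
  coefficients of the polynomial of degree \<open>n - 1\<close> with the roots \<^term>\<open>\<rho> l\<close> form a kernel vector.
\<close>

lemma det_toeplitz_secant:
  assumes "n \<ge> 1"
  shows "det (toeplitz n (secant_point (shift n) (n - 1) \<alpha> \<rho>)) = 0"
proof -
  define p where "p = (\<Prod>l<n-1. [:- \<rho> l, 1:])"
  have degp: "degree p = n - 1"
    unfolding p_def by (simp add: degree_prod_eq_sum_degree)
  have monic: "lead_coeff p = 1"
    unfolding p_def lead_coeff_prod by simp
  define v where "v = vec n (\<lambda>j. coeff p j)"
  have root: "(\<Sum>j<n. coeff p j * \<rho> l ^ j) = 0" if "l < n - 1" for l
  proof -
    have "poly p (\<rho> l) = (\<Sum>j\<le>n-1. coeff p j * \<rho> l ^ j)" by (simp add: poly_altdef degp)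
    moreover have "poly p (\<rho> l) = 0" unfolding p_def poly_prod using that by (auto intro!: prod_zero)
    moreover have "{..n-1} = {..<n}" using assms by auto
    ultimately show ?thesis by simp
  qed
  let ?T = "toeplitz n (secant_point (shift n) (n - 1) \<alpha> \<rho>)"
  have "?T *\<^sub>v v = 0\<^sub>v n"
  proof (rule eq_vecI)
    fix i assume "i < dim_vec (0\<^sub>v n :: complex vec)"
    then have i: "i < n" by simp
    have "(?T *\<^sub>v v) $ i = (\<Sum>j<n. secant_point (shift n) (n - 1) \<alpha> \<rho> (int j - int i) * coeff p j)"
      using i by (simp add: v_def toeplitz_def scalar_prod_def lessThan_atLeast0)
    also have "\<dots> = (\<Sum>j<n. \<Sum>l<n-1. \<alpha> l * \<rho> l ^ (n - 1 - i) * (coeff p j * \<rho> l ^ j))"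
    proof (intro sum.cong refl)
      fix j assume "j \<in> {..<n}"
      have "shift n (int j - int i) = (n - 1 - i) + j" using i by (simp add: shift_def nat_eq_iff)
      then show "secant_point (shift n) (n - 1) \<alpha> \<rho> (int j - int i) * coeff p j =
          (\<Sum>l<n-1. \<alpha> l * \<rho> l ^ (n - 1 - i) * (coeff p j * \<rho> l ^ j))"
        by (simp add: secant_point_def power_add sum_distrib_right sum_distrib_left mult_ac)
    qed
    also have "\<dots> = (\<Sum>l<n-1. \<alpha> l * \<rho> l ^ (n - 1 - i) * (\<Sum>j<n. coeff p j * \<rho> l ^ j))"
      by (subst sum.swap) (simp add: sum_distrib_left)
    finally show "(?T *\<^sub>v v) $ i = 0\<^sub>v n $ i" using root i by simp
  qed (simp add: toeplitz_def)
  moreover have "v \<noteq> 0\<^sub>v n"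
  proof
    assume "v = 0\<^sub>v n"
    then have "v $ (n - 1) = 0" using assms by simp
    then show False using monic degp assms by (simp add: v_def)
  qed
  moreover have "v \<in> carrier_vec n" by (simp add: v_def)
  ultimately show ?thesis using det_0_iff_vec_prod_zero_field[of ?T n] by auto
qed

lemma corner_minor_cong:
  assumes "\<And>k. k \<in> toeplitz_indices n \<Longrightarrow> x k = y k"
  shows "corner_minor n x = corner_minor n y"
proof -
  have "toeplitz (n - 1) (\<lambda>k. x (k - 1)) = toeplitz (n - 1) (\<lambda>k. y (k - 1))"
    by (rule toeplitz_cong, rule assms) (auto simp: toeplitz_indices_def)
  then show ?thesis by (simp add: corner_minor_def)
qed

lemma inj_on_shift: "inj_on (shift n) (toeplitz_indices n)"
  by (auto simp: inj_on_def shift_def toeplitz_indices_def)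

lemma degree_le_corner_minor: "degree_le (n - 1) (corner_minor n)"
proof -
  have "degree_le (n - 1) (\<lambda>x. det (mat (n - 1) (n - 1) (\<lambda>(i, j). x (int j - int i - 1))))"
    by (rule degree_le_det) (rule degree_le_coordinate)
  then show ?thesis by (simp add: corner_minor_def[abs_def] toeplitz_def)
qed

text \<open>
  The minor has degree \<open>n - 1\<close>, too small to vanish on the whole family of singular matrices
  unless it is identically zero.
\<close>

lemma corner_minor_nonzero:
  obtains \<alpha> \<rho> where "corner_minor n (secant_point (shift n) (n - 1) \<alpha> \<rho>) \<noteq> 0"
proof -
  \<comment> \<open>The minor has diagonal \<open>-1\<close> of the matrix as its main diagonal, so here it is the determinant of
    the identity matrix.\<close>
  define x :: "int \<Rightarrow> complex" where "x k = (if k = -1 then 1 else 0)" for k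
  have "toeplitz (n - 1) (\<lambda>k. x (k - 1)) = 1\<^sub>m (n - 1)"
    by (rule eq_matI) (auto simp: toeplitz_def x_def)
  then have "corner_minor n x \<noteq> 0" by (simp add: corner_minor_def)
  moreover have "corner_minor n x = 0" if "\<And>\<alpha> \<rho>. corner_minor n (secant_point (shift n) (n - 1) \<alpha> \<rho>) = 0"
    by (rule vanishes_on_secants_imp_zero[OF _ inj_on_shift _ degree_le_corner_minor order_refl that])
       (auto simp: toeplitz_indices_def intro: corner_minor_cong)
  ultimately show thesis using that by blast
qed

lemma polynomial_fun_corner_minor:
  assumes "\<And>k. polynomial_fun (\<lambda>t. x t k)"
  shows "polynomial_fun (\<lambda>t. corner_minor n (x t))"
  unfolding corner_minor_def toeplitz_def by (rule polynomial_fun_det) (rule assms)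

section \<open>Runs with prescribed branches and computed values\<close>

fun edge_sign :: "edge \<Rightarrow> complex" where
  "edge_sign (Plain i) = 1"
| "edge_sign (Negated i) = -1"

lemma edge_value_eq: "edge_value vs e = edge_sign e * vs ! tail e"
  by (cases e) simp_all

text \<open>
  With the outcomes of all branching nodes prescribed by the set \<^term>\<open>\<beta>\<close> of nodes at which the
  comparison holds, the value of a node is, up to sign, either an input or the value of a computational
  node. The sign and that origin are found by following the branches back. The default for edges that
  do not point backwards only serves termination.
\<close>

function source :: "'v node list \<Rightarrow> nat set \<Rightarrow> nat \<Rightarrow> complex \<times> ('v + nat)" where
  "source ns \<beta> m = (case ns ! m of
     Input v \<Rightarrow> (1, Inl v)
   | Compute q es \<Rightarrow> (1, Inr m)
   | Branch r a b c d \<Rightarrow>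
       (let e = if m \<in> \<beta> then c else d in
        if tail e < m then map_prod ((*) (edge_sign e)) id (source ns \<beta> (tail e)) else (1, Inr m)))"
  by pat_completeness auto
termination by (relation "measure (\<lambda>(_, _, m). m)") auto

declare source.simps [simp del]

definition source_value :: "('v \<Rightarrow> complex) \<Rightarrow> (nat \<Rightarrow> complex) \<Rightarrow> complex \<times> ('v + nat) \<Rightarrow> complex" where
  "source_value x w s = fst s * (case snd s of Inl v \<Rightarrow> x v | Inr k \<Rightarrow> w k)"

text \<open>
  Here \<^term>\<open>w m\<close> stands for the value of the computational node \<^term>\<open>m\<close>, rounding included. The
  point of this description is that a value depends on at most one coordinate of the input once
  \<^term>\<open>\<beta>\<close> and \<^term>\<open>w\<close> are given.
\<close>

definition resolved_edge ::
  "'v node list \<Rightarrow> nat set \<Rightarrow> ('v \<Rightarrow> complex) \<Rightarrow> (nat \<Rightarrow> complex) \<Rightarrow> edge \<Rightarrow> complex" where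
  "resolved_edge ns \<beta> x w e = edge_sign e * source_value x w (source ns \<beta> (tail e))"

text \<open>
  What a computational node returns before rounding. All other positions are treated like computational
  nodes that always return 0, so that a recursion for the computed values need not single them out.
\<close>

definition exact_result ::
  "'v node list \<Rightarrow> nat set \<Rightarrow> ('v \<Rightarrow> complex) \<Rightarrow> (nat \<Rightarrow> complex) \<Rightarrow> nat \<Rightarrow> complex" where
  "exact_result ns \<beta> x w m = (if m < length ns then
     (case ns ! m of Compute q es \<Rightarrow> mpoly_eval (\<lambda>i. resolved_edge ns \<beta> x w (es ! i)) q | _ \<Rightarrow> 0)
     else 0)"

definition comparison ::
  "'v node list \<Rightarrow> nat set \<Rightarrow> ('v \<Rightarrow> complex) \<Rightarrow> (nat \<Rightarrow> complex) \<Rightarrow> nat \<Rightarrow> bool" where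
  "comparison ns \<beta> x w m = (case ns ! m of
     Branch r a b c d \<Rightarrow> r (resolved_edge ns \<beta> x w a) (resolved_edge ns \<beta> x w b) | _ \<Rightarrow> False)"

lemma node_values_snoc:
  "node_values x \<delta> (ns @ [n]) = node_values x \<delta> ns @ [node_value x (\<delta> (length (node_values x \<delta> ns))) (node_values x \<delta> ns) n]"
  by (simp add: node_values_def)

lemma length_node_values [simp]: "length (node_values x \<delta> ns) = length ns"
  by (induction ns rule: rev_induct) (simp_all add: node_values_snoc, simp add: node_values_def)

lemma node_values_nth:
  "m < length ns \<Longrightarrow> node_values x \<delta> ns ! m = node_value x (\<delta> m) (take m (node_values x \<delta> ns)) (ns ! m)"
proof (induction ns rule: rev_induct)
  case Nil
  then show ?case by simp
next
  case (snoc n ns)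
  then show ?case by (cases "m < length ns") (auto simp: node_values_snoc nth_append less_Suc_eq)
qed

lemma Int_eq_mono: "A \<inter> S = B \<inter> S \<Longrightarrow> T \<subseteq> S \<Longrightarrow> A \<inter> T = B \<inter> T"
  by blast

lemma source_cong:
  assumes "\<beta> \<inter> {..m} = \<beta>' \<inter> {..m}"
  shows "source ns \<beta> m = source ns \<beta>' m"
  using assms
proof (induction m rule: less_induct)
  case (less m)
  have m: "m \<in> \<beta> \<longleftrightarrow> m \<in> \<beta>'" using less.prems by blast
  have "source ns \<beta> k = source ns \<beta>' k" if "k < m" for k
    by (rule less.IH[OF that Int_eq_mono[OF less.prems]]) (use that in auto)
  then show ?case
    unfolding source.simps[of ns \<beta> m] source.simps[of ns \<beta>' m]
    by (simp add: m Let_def split: node.split)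
qed

lemma source_Inr: "snd (source ns \<beta> m) = Inr k \<Longrightarrow> k \<le> m"
proof (induction m rule: less_induct)
  case (less m)
  show ?case
    using less.prems less.IH unfolding source.simps[of ns \<beta> m]
    by (fastforce simp: Let_def split: node.splits if_splits)
qed

text \<open>
  The nodes of a well-formed algorithm; for a fixed branching pattern they form a straight-line program.
\<close>

locale straight_line =
  fixes ns :: "'v node list" and R B and I :: "'v set"
  assumes wf: "\<And>m. m < length ns \<Longrightarrow> wf_node R B I m (ns ! m)"
begin

lemma tail_operand:
  assumes "m < length ns" "ns ! m = Compute q es" "i \<in> mvars q"
  shows "tail (es ! i) < m"
proof -
  have "mvars q \<subseteq> {..<length es}" "\<forall>e\<in>set es. tail e < m"
    using wf[OF assms(1)] by (simp_all add: assms(2))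
  then show ?thesis using assms(3) by auto
qed

lemma source_Inl: "m < length ns \<Longrightarrow> snd (source ns \<beta> m) = Inl v \<Longrightarrow> v \<in> I"
proof (induction m rule: less_induct)
  case (less m)
  show ?case
  proof (cases "ns ! m")
    case (Branch r a b c d)
    define e where "e = (if m \<in> \<beta> then c else d)"
    have "tail e < m" using wf[OF less.prems(1)] by (simp add: Branch e_def)
    moreover have "snd (source ns \<beta> (tail e)) = Inl v"
      using less.prems(2) \<open>tail e < m\<close> unfolding source.simps[of ns \<beta> m]
      by (simp add: Branch Let_def flip: e_def)
    ultimately show ?thesis using less.IH[of "tail e"] less.prems(1) by simp
  qed (use less.prems wf[of m] in \<open>auto simp: source.simps[of ns \<beta> m]\<close>)
qed

lemma resolved_edge_cong:
  assumes "\<beta> \<inter> {..<m} = \<beta>' \<inter> {..<m}" "\<And>k. k < m \<Longrightarrow> w k = w' k" "tail e < m"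
  shows "resolved_edge ns \<beta> x w e = resolved_edge ns \<beta>' x w' e"
proof -
  have "\<beta> \<inter> {..tail e} = \<beta>' \<inter> {..tail e}" by (rule Int_eq_mono[OF assms(1)]) (use assms(3) in auto)
  then have "source ns \<beta> (tail e) = source ns \<beta>' (tail e)" by (rule source_cong)
  then show ?thesis
    using source_Inr[of ns \<beta>' "tail e"] assms(2,3)
    by (auto simp: resolved_edge_def source_value_def split: sum.split)
qed

lemma exact_result_cong:
  assumes "\<beta> \<inter> {..<m} = \<beta>' \<inter> {..<m}" "\<And>k. k < m \<Longrightarrow> w k = w' k"
  shows "exact_result ns \<beta> x w m = exact_result ns \<beta>' x w' m"
proof (cases "m < length ns")
  case True
  show ?thesis
  proof (cases "ns ! m")
    case (Compute q es)
    have "resolved_edge ns \<beta> x w (es ! i) = resolved_edge ns \<beta>' x w' (es ! i)" if "i \<in> mvars q" for i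
      by (rule resolved_edge_cong[OF assms tail_operand[OF True Compute that]])
    then show ?thesis by (auto simp: exact_result_def Compute intro: mpoly_eval_cong)
  qed (simp_all add: exact_result_def)
qed (simp add: exact_result_def)

lemma comparison_cong:
  assumes "\<beta> \<inter> {..<m} = \<beta>' \<inter> {..<m}" "\<And>k. k < m \<Longrightarrow> w k = w' k" "m < length ns"
  shows "comparison ns \<beta> x w m = comparison ns \<beta>' x w' m"
proof (cases "ns ! m")
  case (Branch r a b c d)
  have "tail a < m" "tail b < m" using wf[OF assms(3)] by (simp_all add: Branch)
  then show ?thesis using resolved_edge_cong[OF assms(1,2)] by (simp add: comparison_def Branch)
qed (simp_all add: comparison_def)

lemma exact_result_depends:
  assumes "\<And>v. v \<in> I \<Longrightarrow> x v = y v"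
  shows "exact_result ns \<beta> x w m = exact_result ns \<beta> y w m"
proof (cases "m < length ns")
  case True
  show ?thesis
  proof (cases "ns ! m")
    case (Compute q es)
    have "resolved_edge ns \<beta> x w (es ! i) = resolved_edge ns \<beta> y w (es ! i)" if "i \<in> mvars q" for i
    proof -
      have "tail (es ! i) < length ns" using tail_operand[OF True Compute that] True by simp
      then show ?thesis using source_Inl assms
        by (auto simp: resolved_edge_def source_value_def split: sum.split)
    qed
    then show ?thesis by (auto simp: exact_result_def Compute intro: mpoly_eval_cong)
  qed (simp_all add: exact_result_def)
qed (simp add: exact_result_def)

lemma degree_le_exact_result:
  assumes "\<And>q. q \<in> B \<Longrightarrow> total_degree q \<le> d"
  shows "degree_le d (\<lambda>x. exact_result ns \<beta> x w m)"
proof (cases "m < length ns")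
  case True
  show ?thesis
  proof (cases "ns ! m")
    case (Compute q es)
    have "degree_le 1 (\<lambda>x. resolved_edge ns \<beta> x w e)" for e
      unfolding resolved_edge_def source_value_def
      by (cases "snd (source ns \<beta> (tail e))")
        (simp_all only: sum.case degree_le_cmult degree_le_coordinate degree_le_const)
    moreover have "q \<in> B" using wf[OF True] by (simp add: Compute)
    ultimately have "degree_le d (\<lambda>x. mpoly_eval (\<lambda>i. resolved_edge ns \<beta> x w (es ! i)) q)"
      using assms by (intro degree_le_mpoly_eval) auto
    then show ?thesis by (simp add: exact_result_def True Compute)
  qed (simp_all add: exact_result_def True)
qed (simp add: exact_result_def)

lemma polynomial_fun_exact_result:
  assumes "\<And>v. polynomial_fun (\<lambda>t. x t v)" "\<And>k. polynomial_fun (\<lambda>t. w t k)"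
  shows "polynomial_fun (\<lambda>t. exact_result ns \<beta> (x t) (w t) m)"
proof (cases "m < length ns")
  case True
  show ?thesis
  proof (cases "ns ! m")
    case (Compute q es)
    have "polynomial_fun (\<lambda>t. resolved_edge ns \<beta> (x t) (w t) e)" for e
      unfolding resolved_edge_def source_value_def
      by (cases "snd (source ns \<beta> (tail e))") (auto intro!: polynomial_fun_mult assms)
    then show ?thesis by (simp add: exact_result_def True Compute polynomial_fun_mpoly_eval)
  qed (simp_all add: exact_result_def True)
qed (simp add: exact_result_def)

text \<open>
  A pattern \<^term>\<open>\<beta>\<close> and values \<^term>\<open>w\<close> that satisfy the local conditions at every node describe the
  actual run, since the conditions determine the values recursively.
\<close>

lemma node_values_resolved:
  assumes z: "\<And>v. v \<in> I \<Longrightarrow> z v = x v"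
    and w: "\<And>m. m < length ns \<Longrightarrow> w m = exact_result ns \<beta> x w m * (1 + \<delta> m)"
    and \<beta>: "\<And>m. m < length ns \<Longrightarrow> m \<in> \<beta> \<longleftrightarrow> comparison ns \<beta> x w m"
    and e: "tail e < length ns"
  shows "edge_value (node_values z \<delta> ns) e = resolved_edge ns \<beta> x w e"
proof -
  let ?vs = "node_values z \<delta> ns"
  have "?vs ! m = source_value x w (source ns \<beta> m)" if "m < length ns" for m
    using that
  proof (induction m rule: less_induct)
    case (less m)
    have edge: "edge_value (take m ?vs) e = resolved_edge ns \<beta> x w e" if "tail e < m" for e
      using less.IH[OF that] that less.prems by (simp add: edge_value_eq resolved_edge_def)
    show ?case
    proof (cases "ns ! m")
      case (Input v)
      then show ?thesis using wf[OF less.prems] less.prems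
        by (simp add: node_values_nth source.simps[of ns \<beta> m] source_value_def z)
    next
      case (Compute q es)
      have "mpoly_eval (\<lambda>i. edge_value (take m ?vs) (es ! i)) q =
          mpoly_eval (\<lambda>i. resolved_edge ns \<beta> x w (es ! i)) q"
      proof (rule mpoly_eval_cong)
        fix i assume "i \<in> mvars q"
        then have "tail (es ! i) < m" by (rule tail_operand[OF less.prems Compute])
        then show "edge_value (take m ?vs) (es ! i) = resolved_edge ns \<beta> x w (es ! i)" by (rule edge)
      qed
      then show ?thesis using w[OF less.prems] less.prems
        by (simp add: node_values_nth Compute source.simps[of ns \<beta> m] source_value_def exact_result_def)
    next
      case (Branch r a b c d)
      have t: "tail a < m" "tail b < m" "tail c < m" "tail d < m"
        using wf[OF less.prems] by (simp_all add: Branch)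
      have "m \<in> \<beta> \<longleftrightarrow> r (resolved_edge ns \<beta> x w a) (resolved_edge ns \<beta> x w b)"
        using \<beta>[OF less.prems] by (simp add: comparison_def Branch)
      then have "?vs ! m = resolved_edge ns \<beta> x w (if m \<in> \<beta> then c else d)"
        using less.prems t by (simp add: node_values_nth Branch edge)
      then show ?thesis using t
        by (simp add: source.simps[of ns \<beta> m] Branch resolved_edge_def source_value_def Let_def)
    qed
  qed
  then show ?thesis using e by (simp add: edge_value_eq resolved_edge_def)
qed

text \<open>
  The values may depend on the whole pattern as long as the value at each node depends only on the
  branches before it; then the comparisons can be decided one after the other.
\<close>

lemma pattern_exists:
  assumes causal: "\<And>\<beta> \<beta>' m. \<beta> \<inter> {..<m} = \<beta>' \<inter> {..<m} \<Longrightarrow> W \<beta> m = (W \<beta>' m :: complex)"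
  shows "\<exists>\<beta>. \<beta> \<subseteq> {..<length ns} \<and> (\<forall>m<length ns. m \<in> \<beta> \<longleftrightarrow> comparison ns \<beta> x (W \<beta>) m)"
proof -
  have "\<exists>\<beta>. \<beta> \<subseteq> {..<M} \<and> (\<forall>m<M. m \<in> \<beta> \<longleftrightarrow> comparison ns \<beta> x (W \<beta>) m)" if "M \<le> length ns" for M
    using that
  proof (induction M)
    case 0
    show ?case by auto
  next
    case (Suc M)
    then obtain \<beta> where \<beta>: "\<beta> \<subseteq> {..<M}" "\<And>m. m < M \<Longrightarrow> m \<in> \<beta> \<longleftrightarrow> comparison ns \<beta> x (W \<beta>) m"
      by auto
    define \<beta>' where "\<beta>' = \<beta> \<union> (if comparison ns \<beta> x (W \<beta>) M then {M} else {})"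
    have below: "\<beta> \<inter> {..<m} = \<beta>' \<inter> {..<m}" if "m \<le> M" for m
      using that by (auto simp: \<beta>'_def)
    have "comparison ns \<beta> x (W \<beta>) m = comparison ns \<beta>' x (W \<beta>') m" if "m \<le> M" for m
      using that Suc.prems by (intro comparison_cong below causal) auto
    moreover have "m \<in> \<beta>' \<longleftrightarrow> comparison ns \<beta> x (W \<beta>) m" if "m \<le> M" for m
    proof (cases "m = M")
      case True
      then show ?thesis using \<beta>(1) by (auto simp: \<beta>'_def)
    next
      case False
      then have "m < M" using that by simp
      then show ?thesis using \<beta>(2)[of m] by (simp add: \<beta>'_def)
    qed
    ultimately have "\<forall>m<Suc M. m \<in> \<beta>' \<longleftrightarrow> comparison ns \<beta>' x (W \<beta>') m" by (simp add: less_Suc_eq_le)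
    moreover have "\<beta>' \<subseteq> {..<Suc M}" using \<beta>(1) by (auto simp: \<beta>'_def)
    ultimately show ?case by blast
  qed
  then show ?thesis by blast
qed

end

section \<open>Computed values common to nearby inputs\<close>

text \<open>
  Course-of-values recursion, by which computed values arise node after node.
\<close>

fun causal :: "(nat \<Rightarrow> (nat \<Rightarrow> complex) \<Rightarrow> complex) \<Rightarrow> nat \<Rightarrow> complex" where
  "causal F m = F m (\<lambda>k. if k < m then causal F k else 0)"

declare causal.simps [simp del]

lemma causal_cong:
  assumes "\<And>j h. j \<le> m \<Longrightarrow> F j h = G j h"
  shows "causal F m = causal G m"
  using assms
proof (induction m rule: less_induct)
  case (less m)
  have "causal F k = causal G k" if "k < m" for k
    by (rule less.IH[OF that less.prems]) (use that in simp)
  then have "(\<lambda>k. if k < m then causal F k else 0) = (\<lambda>k. if k < m then causal G k else 0)"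
    by auto
  then show ?case using less.prems[of m] by (simp add: causal.simps[of _ m])
qed

definition zero_outside :: "nat set \<Rightarrow> (nat \<Rightarrow> complex) \<Rightarrow> nat \<Rightarrow> complex" where
  "zero_outside K w k = (if k \<in> K then w k else 0)"

context straight_line begin

text \<open>
  The set \<open>K\<close> collects the computed values that are not 0 for structural reasons. It depends on the run,
  so all possible sets are covered, as are all patterns: a single point is to serve for every run.
\<close>

definition generic :: "('v \<Rightarrow> complex) \<Rightarrow> (nat \<Rightarrow> complex) \<Rightarrow> bool" where
  "generic x0 w0 \<longleftrightarrow> (\<forall>\<beta> K m. \<beta> \<subseteq> {..<length ns} \<longrightarrow> K \<subseteq> {..<length ns} \<longrightarrow> m < length ns \<longrightarrow>
     exact_result ns \<beta> x0 (zero_outside K w0) m = 0 \<longrightarrow> (\<forall>x w. exact_result ns \<beta> x (zero_outside K w) m = 0))"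

text \<open>
  One assignment \<^term>\<open>W\<close> of computed values to branching patterns for which every value either is
  strictly inside the rounding tolerance at the generic point or is 0 for structural reasons, that is,
  for all inputs. The generic values need not be close to the exact results, but they arise from some
  rounding errors \<open>\<nu>\<close>. Scaling these by a factor \<open>t\<close> gives values that are polynomials in \<open>t\<close>, so
  the results that do not vanish at \<open>t = 1\<close> vanish only for finitely many \<open>t\<close>.
\<close>

lemma universal_history:
  assumes gen: "generic x0 w0" and eps: "\<epsilon> > 0"
  obtains W :: "nat set \<Rightarrow> nat \<Rightarrow> complex" where
    "\<And>\<beta> \<beta>' m. \<beta> \<inter> {..<m} = \<beta>' \<inter> {..<m} \<Longrightarrow> W \<beta> m = W \<beta>' m"
    "\<And>\<beta> m. \<beta> \<subseteq> {..<length ns} \<Longrightarrow> m < length ns \<Longrightarrow>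
       (exact_result ns \<beta> x0 (W \<beta>) m \<noteq> 0 \<and>
        norm (W \<beta> m - exact_result ns \<beta> x0 (W \<beta>) m) < \<epsilon> * norm (exact_result ns \<beta> x0 (W \<beta>) m)) \<or>
       (W \<beta> m = 0 \<and> (\<forall>x. exact_result ns \<beta> x (W \<beta>) m = 0))"
proof -
  define ex where "ex \<beta> h m = exact_result ns \<beta> x0 h m" for \<beta> h m
  have ex_cong: "ex \<beta> h m = ex \<beta>' h' m"
    if "\<beta> \<inter> {..<m} = \<beta>' \<inter> {..<m}" "\<And>k. k < m \<Longrightarrow> h k = h' k" for \<beta> \<beta>' h h' m
    unfolding ex_def by (rule exact_result_cong[OF that])
  have ex_prefix: "ex \<beta> (\<lambda>k. if k < m then h k else 0) m = ex \<beta> h m" for \<beta> h m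
    by (rule ex_cong) auto
  \<comment> \<open>The generic values \<open>w0\<close>, with 0 at the nodes whose exact result is then 0.\<close>
  define G where "G \<beta> = causal (\<lambda>m h. if ex \<beta> h m = 0 then 0 else w0 m)" for \<beta>
  \<comment> \<open>The rounding errors that produce \<open>G\<close>.\<close>
  define \<nu> where "\<nu> \<beta> m = (if ex \<beta> (G \<beta>) m = 0 then 0 else w0 m / ex \<beta> (G \<beta>) m - 1)" for \<beta> m
  define V where "V \<beta> t = causal (\<lambda>m h. ex \<beta> h m * (1 + t * \<nu> \<beta> m))" for \<beta> t
  have G: "G \<beta> m = (if ex \<beta> (G \<beta>) m = 0 then 0 else w0 m)" for \<beta> m
    unfolding G_def by (subst causal.simps) (simp only: ex_prefix)
  have V: "V \<beta> t m = ex \<beta> (V \<beta> t) m * (1 + t * \<nu> \<beta> m)" for \<beta> t m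
    unfolding V_def by (subst causal.simps) (simp only: ex_prefix)
  have agree: "\<beta> \<inter> {..<j} = \<beta>' \<inter> {..<j}" if "\<beta> \<inter> {..<m} = \<beta>' \<inter> {..<m}" "j \<le> m" for \<beta> \<beta>' :: "nat set" and m j
    by (rule Int_eq_mono[OF that(1)]) (use that(2) in auto)
  have ex_agree: "ex \<beta> h j = ex \<beta>' h j" if "\<beta> \<inter> {..<m} = \<beta>' \<inter> {..<m}" "j \<le> m" for \<beta> \<beta>' m j h
    by (rule ex_cong[OF agree[OF that]]) simp
  have G_agree: "G \<beta> j = G \<beta>' j" if "\<beta> \<inter> {..<m} = \<beta>' \<inter> {..<m}" "j \<le> m" for \<beta> \<beta>' m j
    unfolding G_def
  proof (rule causal_cong)
    fix i h assume "i \<le> j"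
    then have "ex \<beta> h i = ex \<beta>' h i" using that(2) by (intro ex_agree[OF that(1)]) simp
    then show "(if ex \<beta> h i = 0 then 0 else w0 i) = (if ex \<beta>' h i = 0 then 0 else w0 i)" by simp
  qed
  have \<nu>_agree: "\<nu> \<beta> j = \<nu> \<beta>' j" if "\<beta> \<inter> {..<m} = \<beta>' \<inter> {..<m}" "j \<le> m" for \<beta> \<beta>' m j
  proof -
    have "ex \<beta> (G \<beta>) j = ex \<beta>' (G \<beta>') j"
      by (rule ex_cong[OF agree[OF that]], rule G_agree[OF that(1)]) (use that(2) in simp)
    then show ?thesis by (simp add: \<nu>_def)
  qed
  have V_agree: "V \<beta> t m = V \<beta>' t m" if "\<beta> \<inter> {..<m} = \<beta>' \<inter> {..<m}" for \<beta> \<beta>' t m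
    unfolding V_def
  proof (rule causal_cong)
    fix i h assume "i \<le> m"
    then show "ex \<beta> h i * (1 + t * \<nu> \<beta> i) = ex \<beta>' h i * (1 + t * \<nu> \<beta>' i)"
      using ex_agree[OF that] \<nu>_agree[OF that] by simp
  qed
  have V1: "V \<beta> 1 m = G \<beta> m" for \<beta> m
  proof (induction m rule: less_induct)
    case (less m)
    have "ex \<beta> (V \<beta> 1) m = ex \<beta> (G \<beta>) m" by (rule ex_cong[OF refl less.IH])
    then show ?case unfolding V[of \<beta> 1 m] by (subst G) (simp add: \<nu>_def)
  qed
  \<comment> \<open>The nodes with nonzero result; all others return 0 for every input and every \<open>t\<close>.\<close>
  define K where "K \<beta> = {m. ex \<beta> (G \<beta>) m \<noteq> 0}" for \<beta>
  have K_sub: "K \<beta> \<subseteq> {..<length ns}" for \<beta>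
    by (auto simp: K_def ex_def exact_result_def split: if_splits)
  have G_supp: "G \<beta> = zero_outside (K \<beta>) w0" for \<beta>
    by (rule ext) (subst G, simp add: zero_outside_def K_def)
  have dead: "exact_result ns \<beta> x (zero_outside (K \<beta>) w) m = 0" if "\<beta> \<subseteq> {..<length ns}" "m \<notin> K \<beta>" for \<beta> x w m
  proof (cases "m < length ns")
    case True
    have "exact_result ns \<beta> x0 (zero_outside (K \<beta>) w0) m = 0"
      using that(2) unfolding G_supp[symmetric] by (simp add: K_def ex_def)
    then show ?thesis using gen that(1) K_sub True unfolding generic_def by blast
  qed (simp add: exact_result_def)
  have V_dead: "V \<beta> t m = 0" if \<beta>: "\<beta> \<subseteq> {..<length ns}" and "m \<notin> K \<beta>" for \<beta> t m
    using that(2)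
  proof (induction m rule: less_induct)
    case (less m)
    have "ex \<beta> (V \<beta> t) m = ex \<beta> (zero_outside (K \<beta>) (V \<beta> t)) m"
      by (rule ex_cong) (use less.IH in \<open>auto simp: zero_outside_def\<close>)
    also have "\<dots> = 0" unfolding ex_def by (rule dead[OF \<beta> less.prems])
    finally show ?case by (subst V) simp
  qed
  have V_supp: "V \<beta> t = zero_outside (K \<beta>) (V \<beta> t)" if "\<beta> \<subseteq> {..<length ns}" for \<beta> t
    using V_dead[OF that] by (auto simp: zero_outside_def)
  have poly: "polynomial_fun (\<lambda>t. V \<beta> t m)" for \<beta> m
  proof (induction m rule: less_induct)
    case (less m)
    have "polynomial_fun (\<lambda>t. if k < m then V \<beta> t k else 0)" for k
      using less.IH by (cases "k < m") simp_all
    then have "polynomial_fun (\<lambda>t. ex \<beta> (\<lambda>k. if k < m then V \<beta> t k else 0) m)"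
      unfolding ex_def by (intro polynomial_fun_exact_result) simp_all
    then have "polynomial_fun (\<lambda>t. ex \<beta> (V \<beta> t) m)" unfolding ex_prefix .
    then have "polynomial_fun (\<lambda>t. ex \<beta> (V \<beta> t) m * (1 + t * \<nu> \<beta> m))"
      by (intro polynomial_fun_mult polynomial_fun_add) simp_all
    then show ?case by (subst V)
  qed
  have "eventually (\<lambda>t. \<forall>\<beta>\<in>Pow {..<length ns}. \<forall>m\<in>{..<length ns}. norm (t * \<nu> \<beta> m) < \<epsilon> \<and>
      (m \<in> K \<beta> \<longrightarrow> ex \<beta> (V \<beta> t) m \<noteq> 0)) (at 0)"
  proof (intro eventually_ball_finite ballI eventually_conj)
    fix \<beta> m
    have "((\<lambda>t. t * \<nu> \<beta> m) \<longlongrightarrow> 0 * \<nu> \<beta> m) (at 0)" by (intro tendsto_intros)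
    then have "((\<lambda>t. norm (t * \<nu> \<beta> m)) \<longlongrightarrow> 0) (at 0)" using tendsto_norm_zero by fastforce
    then show "eventually (\<lambda>t. norm (t * \<nu> \<beta> m) < \<epsilon>) (at 0)" by (rule order_tendstoD(2)[OF _ eps])
    show "eventually (\<lambda>t. m \<in> K \<beta> \<longrightarrow> ex \<beta> (V \<beta> t) m \<noteq> 0) (at 0)"
    proof (cases "m \<in> K \<beta>")
      case True
      have "polynomial_fun (\<lambda>t. ex \<beta> (V \<beta> t) m)"
        unfolding ex_def by (intro polynomial_fun_exact_result poly) simp_all
      moreover have "ex \<beta> (V \<beta> 1) m \<noteq> 0"
      proof -
        have "V \<beta> 1 = G \<beta>" by (rule ext) (rule V1)
        then show ?thesis using True by (simp add: K_def)
      qed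
      ultimately show ?thesis using polynomial_fun_eventually_nonzero[of _ 1 0] by simp
    qed simp
  qed auto
  from eventually_happens'[OF at_neq_bot this]
  obtain t where all: "\<forall>\<beta>\<in>Pow {..<length ns}. \<forall>m\<in>{..<length ns}. norm (t * \<nu> \<beta> m) < \<epsilon> \<and>
      (m \<in> K \<beta> \<longrightarrow> ex \<beta> (V \<beta> t) m \<noteq> 0)" ..
  have t: "norm (t * \<nu> \<beta> m) < \<epsilon>" "m \<in> K \<beta> \<Longrightarrow> ex \<beta> (V \<beta> t) m \<noteq> 0"
    if "\<beta> \<subseteq> {..<length ns}" "m < length ns" for \<beta> m
    using all[THEN bspec, of \<beta>, THEN bspec, of m] that by simp_all
  show thesis
  proof (rule that[of "\<lambda>\<beta>. V \<beta> t"])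
    show "V \<beta> t m = V \<beta>' t m" if "\<beta> \<inter> {..<m} = \<beta>' \<inter> {..<m}" for \<beta> \<beta>' m
      by (rule V_agree[OF that])
  next
    fix \<beta> m assume \<beta>: "\<beta> \<subseteq> {..<length ns}" and m: "m < length ns"
    show "(exact_result ns \<beta> x0 (V \<beta> t) m \<noteq> 0 \<and>
        norm (V \<beta> t m - exact_result ns \<beta> x0 (V \<beta> t) m) < \<epsilon> * norm (exact_result ns \<beta> x0 (V \<beta> t) m)) \<or>
       (V \<beta> t m = 0 \<and> (\<forall>x. exact_result ns \<beta> x (V \<beta> t) m = 0))"
    proof (cases "m \<in> K \<beta>")
      case True
      have nz: "ex \<beta> (V \<beta> t) m \<noteq> 0" by (rule t(2)[OF \<beta> m True])
      have "V \<beta> t m - ex \<beta> (V \<beta> t) m = (t * \<nu> \<beta> m) * ex \<beta> (V \<beta> t) m"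
        by (subst V) (simp add: algebra_simps)
      then have "norm (V \<beta> t m - ex \<beta> (V \<beta> t) m) = norm (t * \<nu> \<beta> m) * norm (ex \<beta> (V \<beta> t) m)"
        by (simp only: norm_mult)
      also have "\<dots> < \<epsilon> * norm (ex \<beta> (V \<beta> t) m)"
        using nz by (intro mult_strict_right_mono[OF t(1)[OF \<beta> m]]) simp
      finally have "norm (V \<beta> t m - ex \<beta> (V \<beta> t) m) < \<epsilon> * norm (ex \<beta> (V \<beta> t) m)" .
      then show ?thesis using nz by (simp add: ex_def)
    next
      case False
      have "exact_result ns \<beta> x (V \<beta> t) m = 0" for x
        using dead[OF \<beta> False, of x "V \<beta> t"] V_supp[OF \<beta>, of t] by simp
      then show ?thesis using V_dead[OF \<beta> False] by simp
    qed
  qed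
qed

end

text \<open>
  Coefficients and bases of a point of the secant variety are packed together with computed values, so
  that all of them can be chosen generic jointly.
\<close>

datatype parameter = Coef nat | Base nat | Mem nat

context straight_line begin

text \<open>
  An exact result is a polynomial of degree at most \<^term>\<open>k\<close> in the inputs, so if it is zero for all
  choices of the parameters then it is zero for all inputs. The remaining ones, finitely many, have a
  common point where none of them vanishes, and it can be chosen to avoid the zeros of finitely many
  further polynomials.
\<close>

lemma exists_generic:
  fixes e :: "'v \<Rightarrow> nat"
  assumes I: "finite I" "inj_on e I" and deg: "\<And>q. q \<in> B \<Longrightarrow> total_degree q \<le> k"
    and H: "finite H" "\<And>h. h \<in> H \<Longrightarrow> polynomial_on_lines h" "\<And>h. h \<in> H \<Longrightarrow> \<exists>a. h a \<noteq> 0"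
  shows "\<exists>P. generic (secant_point e k (\<lambda>l. P (Coef l)) (\<lambda>l. P (Base l))) (\<lambda>i. P (Mem i)) \<and>
     (\<forall>h\<in>H. h P \<noteq> 0)"
proof -
  define result where "result = (\<lambda>(\<beta>, K, m) P. exact_result ns \<beta>
      (secant_point e k (\<lambda>l. P (Coef l)) (\<lambda>l. P (Base l))) (zero_outside K (\<lambda>i. P (Mem i))) m)"
  define T where "T = Pow {..<length ns} \<times> Pow {..<length ns} \<times> {..<length ns}"
  define H' where "H' = H \<union> {h \<in> result ` T. \<exists>a. h a \<noteq> 0}"
  have poly: "polynomial_on_lines (result i)" for i
  proof -
    have line: "polynomial_fun (\<lambda>t. a j + t * b j)" for a b :: "parameter \<Rightarrow> complex" and j
      by (intro polynomial_fun_add polynomial_fun_mult) simp_all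
    have mem: "polynomial_fun (\<lambda>t. zero_outside K (\<lambda>i. a (Mem i) + t * b (Mem i)) j)" for K a b j
      by (cases "j \<in> K") (simp_all add: zero_outside_def line)
    obtain \<beta> K m where i: "i = (\<beta>, K, m)" by (cases i)
    show ?thesis
      unfolding polynomial_on_lines_def result_def i prod.case
      by (intro allI polynomial_fun_exact_result polynomial_fun_secant_point line mem)
  qed
  have "\<exists>a. \<forall>h\<in>H'. h a \<noteq> 0"
  proof (rule common_nonzero)
    show "finite H'" using H(1) by (simp add: H'_def T_def)
    show "polynomial_on_lines h" if "h \<in> H'" for h using that H(2) poly by (auto simp: H'_def)
    show "\<exists>a. h a \<noteq> 0" if "h \<in> H'" for h using that H(3) by (auto simp: H'_def)
  qed
  then obtain P where P: "\<forall>h\<in>H'. h P \<noteq> 0" ..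
  have "generic (secant_point e k (\<lambda>l. P (Coef l)) (\<lambda>l. P (Base l))) (\<lambda>i. P (Mem i))"
    unfolding generic_def
  proof (intro allI impI)
    fix \<beta> K m x w
    assume T: "\<beta> \<subseteq> {..<length ns}" "K \<subseteq> {..<length ns}" "m < length ns"
      and zero: "exact_result ns \<beta> (secant_point e k (\<lambda>l. P (Coef l)) (\<lambda>l. P (Base l)))
         (zero_outside K (\<lambda>i. P (Mem i))) m = 0"
    have "result (\<beta>, K, m) P = 0" using zero by (simp add: result_def)
    then have "result (\<beta>, K, m) \<notin> H'" using P by blast
    moreover have "(\<beta>, K, m) \<in> T" using T by (simp add: T_def)
    ultimately have all: "result (\<beta>, K, m) a = 0" for a unfolding H'_def by blast
    show "exact_result ns \<beta> x (zero_outside K w) m = 0"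
    proof (rule vanishes_on_secants_imp_zero[OF I, where d = k and k = k and
          f = "\<lambda>x. exact_result ns \<beta> x (zero_outside K w) m"])
      show "exact_result ns \<beta> x (zero_outside K w) m = exact_result ns \<beta> y (zero_outside K w) m"
        if "\<And>i. i \<in> I \<Longrightarrow> x i = y i" for x y
        by (rule exact_result_depends[OF that])
      show "degree_le k (\<lambda>x. exact_result ns \<beta> x (zero_outside K w) m)" by (rule degree_le_exact_result[OF deg])
      show "exact_result ns \<beta> (secant_point e k \<alpha> \<rho>) (zero_outside K w) m = 0" for \<alpha> \<rho>
        using all[of "case_parameter \<alpha> \<rho> w"] by (simp add: result_def)
    qed simp
  qed
  then show ?thesis using P by (auto simp: H'_def)
qed

definition feasible :: "real \<Rightarrow> nat set \<Rightarrow> (nat \<Rightarrow> complex) \<Rightarrow> ('v \<Rightarrow> complex) \<Rightarrow> bool" where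
  "feasible \<epsilon> \<beta> w x \<longleftrightarrow>
     (\<forall>m<length ns. \<exists>d. norm d \<le> \<epsilon> \<and> w m = exact_result ns \<beta> x w m * (1 + d))"

text \<open>
  The strict inequality at \<^term>\<open>x0\<close> persists nearby, and a structural zero persists everywhere. Hence
  the computed values themselves need not change when the input moves a little: the rounding errors
  absorb the difference.
\<close>

lemma feasible_nearby:
  assumes "\<And>m. m < length ns \<Longrightarrow>
       (exact_result ns \<beta> x0 w m \<noteq> 0 \<and>
        norm (w m - exact_result ns \<beta> x0 w m) < \<epsilon> * norm (exact_result ns \<beta> x0 w m)) \<or>
       (w m = 0 \<and> (\<forall>x. exact_result ns \<beta> x w m = 0))"
    and eps: "\<epsilon> > 0"
  shows "eventually (\<lambda>s. feasible \<epsilon> \<beta> w (\<lambda>i. x0 i + s * g i)) (at 0)"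
proof -
  have "eventually (\<lambda>s. \<exists>d. norm d \<le> \<epsilon> \<and> w m = exact_result ns \<beta> (\<lambda>i. x0 i + s * g i) w m * (1 + d)) (at 0)"
    if m: "m < length ns" for m
    using assms(1)[OF m]
  proof (elim disjE conjE)
    assume "w m = 0" "\<forall>x. exact_result ns \<beta> x w m = 0"
    then show ?thesis using eps by (auto intro!: exI[of _ 0])
  next
    define u where "u s = exact_result ns \<beta> (\<lambda>i. x0 i + s * g i) w m" for s
    assume "norm (w m - exact_result ns \<beta> x0 w m) < \<epsilon> * norm (exact_result ns \<beta> x0 w m)"
    then have u0: "norm (w m - u 0) < \<epsilon> * norm (u 0)" by (simp add: u_def)
    have "polynomial_fun u"
      unfolding u_def by (intro polynomial_fun_exact_result polynomial_fun_add polynomial_fun_mult) simp_all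
    then have lim: "(u \<longlongrightarrow> u 0) (at 0)" by (rule polynomial_fun_tendsto)
    have "((\<lambda>s. \<epsilon> * norm (u s) - norm (w m - u s)) \<longlongrightarrow> \<epsilon> * norm (u 0) - norm (w m - u 0)) (at 0)"
      by (intro tendsto_intros lim)
    then have "eventually (\<lambda>s. \<epsilon> * norm (u s) - norm (w m - u s) > 0) (at 0)"
      using u0 by (intro order_tendstoD(1)) auto
    then show ?thesis
    proof (rule eventually_mono)
      fix s assume s: "\<epsilon> * norm (u s) - norm (w m - u s) > 0"
      then have nz: "u s \<noteq> 0" by auto
      have "w m / u s - 1 = (w m - u s) / u s" using nz by (simp add: diff_divide_distrib)
      then have "norm (w m / u s - 1) \<le> \<epsilon>"
        using s nz by (simp add: norm_divide divide_le_eq)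
      moreover have "w m = u s * (1 + (w m / u s - 1))" using nz by simp
      ultimately show "\<exists>d. norm d \<le> \<epsilon> \<and> w m = exact_result ns \<beta> (\<lambda>i. x0 i + s * g i) w m * (1 + d)"
        unfolding u_def by blast
    qed
  qed
  then have "eventually (\<lambda>s. \<forall>m\<in>{..<length ns}. \<exists>d. norm d \<le> \<epsilon> \<and>
      w m = exact_result ns \<beta> (\<lambda>i. x0 i + s * g i) w m * (1 + d)) (at 0)"
    by (intro eventually_ball_finite) auto
  then show ?thesis by (simp add: feasible_def Ball_def)
qed

lemma feasible_run:
  assumes "feasible \<epsilon> \<beta> w x" "\<epsilon> > 0" "tail e < length ns"
    and "\<And>m. m < length ns \<Longrightarrow> m \<in> \<beta> \<longleftrightarrow> comparison ns \<beta> x w m"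
  shows "\<exists>\<delta>. (\<forall>i. norm (\<delta> i) \<le> \<epsilon>) \<and>
     edge_value (node_values (restrict x I) \<delta> ns) e = resolved_edge ns \<beta> x w e"
proof -
  have "\<forall>m. \<exists>d. m < length ns \<longrightarrow> norm d \<le> \<epsilon> \<and> w m = exact_result ns \<beta> x w m * (1 + d)"
    using assms(1) unfolding feasible_def by blast
  from choice[OF this]
  obtain d where "\<forall>m. m < length ns \<longrightarrow> norm (d m) \<le> \<epsilon> \<and> w m = exact_result ns \<beta> x w m * (1 + d m)" ..
  then have d: "norm (d m) \<le> \<epsilon>" "w m = exact_result ns \<beta> x w m * (1 + d m)"
    if "m < length ns" for m
    using that by blast+
  define \<delta> where "\<delta> m = (if m < length ns then d m else 0)" for m
  have "edge_value (node_values (restrict x I) \<delta> ns) e = resolved_edge ns \<beta> x w e"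
  proof (rule node_values_resolved[OF _ _ assms(4,3)])
    show "w m = exact_result ns \<beta> x w m * (1 + \<delta> m)" if "m < length ns" for m
      using d(2)[OF that] that unfolding \<delta>_def by simp
  qed simp
  moreover have "norm (\<delta> i) \<le> \<epsilon>" for i using d assms(2) by (simp add: \<delta>_def)
  ultimately show ?thesis by blast
qed

lemma resolved_edge_one_input:
  assumes "tail e < length ns" "I \<noteq> {}"
  shows "\<exists>v\<in>I. \<forall>x y. x v = y v \<longrightarrow> resolved_edge ns \<beta> x w e = resolved_edge ns \<beta> y w e"
proof (cases "snd (source ns \<beta> (tail e))")
  case (Inl v)
  then have "v \<in> I" using source_Inl assms(1) by blast
  then show ?thesis by (intro bexI[of _ v]) (simp_all add: resolved_edge_def source_value_def Inl)
next
  case (Inr k)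
  then show ?thesis using assms(2) by (auto simp: resolved_edge_def source_value_def)
qed

lemma comparison_two_inputs:
  assumes "m < length ns" "I \<noteq> {}"
  shows "\<exists>v\<in>I. \<exists>v'\<in>I. \<forall>x y. x v = y v \<longrightarrow> x v' = y v' \<longrightarrow> comparison ns \<beta> x w m = comparison ns \<beta> y w m"
proof (cases "ns ! m")
  case (Branch r a b c d)
  have len: "tail a < length ns" "tail b < length ns"
    using wf[OF assms(1)] assms(1) by (simp_all add: Branch)
  obtain v where v: "v \<in> I"
    "\<forall>x y. x v = y v \<longrightarrow> resolved_edge ns \<beta> x w a = resolved_edge ns \<beta> y w a"
    using resolved_edge_one_input[OF len(1) assms(2)] ..
  obtain v' where v': "v' \<in> I"
    "\<forall>x y. x v' = y v' \<longrightarrow> resolved_edge ns \<beta> x w b = resolved_edge ns \<beta> y w b"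
    using resolved_edge_one_input[OF len(2) assms(2)] ..
  have "comparison ns \<beta> x w m = comparison ns \<beta> y w m" if "x v = y v" "x v' = y v'" for x y
    unfolding comparison_def Branch node.case v(2)[rule_format, of x y, OF that(1)]
      v'(2)[rule_format, of x y, OF that(2)] ..
  then show ?thesis using v(1) v'(1) by blast
qed (use assms(2) in \<open>auto simp: comparison_def\<close>)

end

section \<open>Confusing singular with nonsingular matrices\<close>

text \<open>
  Displacements in the plane spanned by two of the exponentials of which the generic point is composed.
  Along such displacements the Toeplitz matrix stays singular.
\<close>

definition plane :: "nat \<Rightarrow> complex \<Rightarrow> complex \<Rightarrow> complex \<times> complex \<Rightarrow> int \<Rightarrow> complex" where
  "plane n r0 r1 b i = fst b * r0 ^ shift n i + snd b * r1 ^ shift n i"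

lemma plane_homothet:
  "plane n r0 r1 (homothet h f) i = plane n r0 r1 (fst h) i + of_nat (snd h) * plane n r0 r1 f i"
  by (simp add: plane_def homothet_def scaleR_conv_of_real algebra_simps)

lemma secant_point_plane:
  assumes "k \<ge> 2"
  shows "(\<lambda>i. secant_point (shift n) k \<alpha> \<rho> i + s * plane n (\<rho> 0) (\<rho> 1) b i) =
    secant_point (shift n) k (\<alpha>(0 := \<alpha> 0 + s * fst b, 1 := \<alpha> 1 + s * snd b)) \<rho>"
proof
  fix i
  obtain r where k: "k = Suc (Suc r)" using assms by (metis Suc_le_D numeral_2_eq_2 Suc_le_mono)
  show "secant_point (shift n) k \<alpha> \<rho> i + s * plane n (\<rho> 0) (\<rho> 1) b i =
    secant_point (shift n) k (\<alpha>(0 := \<alpha> 0 + s * fst b, 1 := \<alpha> 1 + s * snd b)) \<rho> i"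
    unfolding secant_point_def k plane_def sum.lessThan_Suc_shift
    by (simp add: algebra_simps)
qed

text \<open>
  Cramer's rule for the two coefficients.
\<close>

lemma plane_interpolation:
  assumes "r0 ^ shift n j * r1 ^ shift n i \<noteq> r0 ^ shift n i * r1 ^ shift n j"
  obtains f where "plane n r0 r1 f i = 1" "plane n r0 r1 f j = 0"
proof
  define D where "D = r0 ^ shift n i * r1 ^ shift n j - r0 ^ shift n j * r1 ^ shift n i"
  have "D \<noteq> 0" using assms by (simp add: D_def)
  let ?f = "(r1 ^ shift n j / D, - (r0 ^ shift n j) / D)"
  have "plane n r0 r1 ?f i = (r0 ^ shift n i * r1 ^ shift n j - r0 ^ shift n j * r1 ^ shift n i) / D"
    by (simp add: plane_def diff_divide_distrib mult_ac)
  then show "plane n r0 r1 ?f i = 1" using \<open>D \<noteq> 0\<close> by (simp add: D_def)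
  show "plane n r0 r1 ?f j = 0" by (simp add: plane_def mult_ac)
qed

text \<open>
  Two conditions are added to genericity: the determinant has to react to the corner entry, and the
  first two exponentials must not be proportional on the corner and another diagonal.
\<close>

lemma exists_generic_toeplitz:
  assumes "straight_line ns R B (toeplitz_indices n)" and "\<And>q. q \<in> B \<Longrightarrow> total_degree q \<le> n - 1"
  obtains \<alpha> \<rho> w where
    "straight_line.generic ns (secant_point (shift n) (n - 1) \<alpha> \<rho>) w"
    "corner_minor n (secant_point (shift n) (n - 1) \<alpha> \<rho>) \<noteq> 0"
    "\<And>j. j \<in> toeplitz_indices n \<Longrightarrow> j \<noteq> int n - 1 \<Longrightarrow>
       \<rho> 0 ^ shift n j * \<rho> 1 ^ shift n (int n - 1) \<noteq> \<rho> 0 ^ shift n (int n - 1) * \<rho> 1 ^ shift n j"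
proof -
  interpret straight_line ns R B "toeplitz_indices n" by (rule assms(1))
  define minor where "minor P = corner_minor n (secant_point (shift n) (n - 1) (\<lambda>l. P (Coef l)) (\<lambda>l. P (Base l)))" for P
  define ratio where "ratio j P = P (Base 0) ^ shift n j * P (Base 1) ^ shift n (int n - 1)
      - P (Base 0) ^ shift n (int n - 1) * P (Base 1) ^ shift n j" for j and P :: "parameter \<Rightarrow> complex"
  define J where "J = toeplitz_indices n - {int n - 1}"
  have fin: "finite (toeplitz_indices n)" by (simp add: toeplitz_indices_def)
  have line: "polynomial_fun (\<lambda>t. a j + t * b j)" for a b :: "parameter \<Rightarrow> complex" and j
    by (intro polynomial_fun_add polynomial_fun_mult) simp_all
  have "\<exists>P. generic (secant_point (shift n) (n - 1) (\<lambda>l. P (Coef l)) (\<lambda>l. P (Base l))) (\<lambda>i. P (Mem i)) \<and>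
     (\<forall>h\<in>insert minor (ratio ` J). h P \<noteq> 0)"
  proof (rule exists_generic[OF fin inj_on_shift assms(2)])
    show "finite (insert minor (ratio ` J))" using fin by (simp add: J_def)
  next
    fix h assume "h \<in> insert minor (ratio ` J)"
    then consider "h = minor" | j where "j \<in> J" "h = ratio j" by blast
    then show "polynomial_on_lines h"
    proof cases
      case 1
      show ?thesis unfolding 1 polynomial_on_lines_def minor_def
        by (intro allI polynomial_fun_corner_minor polynomial_fun_secant_point line)
    next
      case 2
      show ?thesis unfolding 2 polynomial_on_lines_def ratio_def
        by (intro allI polynomial_fun_diff polynomial_fun_mult polynomial_fun_power line)
    qed
  next
    fix h assume "h \<in> insert minor (ratio ` J)"
    then consider "h = minor" | j where "j \<in> J" "h = ratio j" by blast
    then show "\<exists>a. h a \<noteq> 0"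
    proof cases
      case 1
      obtain \<alpha> \<rho> where "corner_minor n (secant_point (shift n) (n - 1) \<alpha> \<rho>) \<noteq> 0"
        by (rule corner_minor_nonzero)
      then have "minor (case_parameter \<alpha> \<rho> (\<lambda>_. 0)) \<noteq> 0" by (simp add: minor_def)
      then show ?thesis unfolding 1 by blast
    next
      case 2
      have "shift n j \<noteq> shift n (int n - 1)"
        using 2(1) by (auto simp: J_def shift_def toeplitz_indices_def)
      then have "(2::complex) ^ shift n j \<noteq> 2 ^ shift n (int n - 1)"
        by (metis norm_power norm_numeral power_inject_exp one_less_numeral_iff semiring_norm(76))
      then have "ratio j (case_parameter (\<lambda>_. 0) (\<lambda>l. if l = 0 then 1 else 2) (\<lambda>_. 0)) \<noteq> 0"
        by (simp add: ratio_def)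
      then show ?thesis unfolding 2 by blast
    qed
  qed
  then obtain P where P: "generic (secant_point (shift n) (n - 1) (\<lambda>l. P (Coef l)) (\<lambda>l. P (Base l))) (\<lambda>i. P (Mem i))"
    "minor P \<noteq> 0" "\<And>j. j \<in> J \<Longrightarrow> ratio j P \<noteq> 0" by auto
  show thesis
  proof (rule that[OF P(1)])
    show "corner_minor n (secant_point (shift n) (n - 1) (\<lambda>l. P (Coef l)) (\<lambda>l. P (Base l))) \<noteq> 0"
      using P(2) by (simp add: minor_def)
    show "P (Base 0) ^ shift n j * P (Base 1) ^ shift n (int n - 1) \<noteq>
        P (Base 0) ^ shift n (int n - 1) * P (Base 1) ^ shift n j"
      if "j \<in> toeplitz_indices n" "j \<noteq> int n - 1" for j
      using P(3)[of j] that by (simp add: ratio_def J_def)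
  qed
qed

text \<open>
  Already one size is impossible: \<open>n - 1\<close> has to bound the degrees, for the generic point to exist,
  and has to be at least 2, for the plane of singular displacements to exist.
\<close>

theorem toeplitz_det_not_accurately_evaluable:
  assumes n: "n \<ge> 3" and deg: "\<And>q. q \<in> B \<Longrightarrow> total_degree q \<le> n - 1"
  shows "\<not> accurately_evaluable R B (toeplitz_indices n) (complex_space (toeplitz_indices n)) (toeplitz_det n)"
proof
  define I where "I = toeplitz_indices n"
  define corner where "corner = int n - 1"
  assume "accurately_evaluable R B (toeplitz_indices n) (complex_space (toeplitz_indices n)) (toeplitz_det n)"
  then obtain A where A: "wf_algorithm R B I A" and acc: "accurate_on (complex_space I) (toeplitz_det n) A"
    by (auto simp: accurately_evaluable_def algorithm_for_def I_def)
  define ns where "ns = nodes A"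
  have out: "tail (out_edge A) < length ns" using A by (simp add: wf_algorithm_def ns_def)
  interpret straight_line ns R B I
    by unfold_locales (use A in \<open>simp add: wf_algorithm_def ns_def\<close>)
  have I_ne: "I \<noteq> {}" and I_fin: "finite I" and zero_I: "0 \<in> I" "0 \<noteq> corner"
    using n by (auto simp: I_def toeplitz_indices_def corner_def)
  obtain \<epsilon> where eps: "0 < \<epsilon>" and run: "\<And>x \<delta>. (\<And>i. norm (\<delta> i) \<le> \<epsilon>) \<Longrightarrow>
      norm (p_comp A (restrict x I) \<delta> - det (toeplitz n x)) \<le> 1/2 * norm (det (toeplitz n x))"
  proof -
    obtain \<epsilon> where "0 < \<epsilon>" "\<forall>x\<in>complex_space I. \<forall>\<delta>. (\<forall>i. norm (\<delta> i) \<le> \<epsilon>) \<longrightarrow>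
        norm (p_comp A x \<delta> - mpoly_eval x (toeplitz_det n)) \<le> 1/2 * norm (mpoly_eval x (toeplitz_det n))"
      using acc[unfolded accurate_on_def, rule_format, of "1/2"] by auto
    moreover have "mpoly_eval (restrict x I) (toeplitz_det n) = det (toeplitz n x)" for x
      unfolding mpoly_eval_toeplitz_det by (rule arg_cong[OF toeplitz_cong]) (simp add: I_def)
    ultimately show thesis using that by (metis restrict_PiE_iff UNIV_I)
  qed
  obtain \<alpha> \<rho> w0 where gen: "generic (secant_point (shift n) (n - 1) \<alpha> \<rho>) w0"
    and minor: "corner_minor n (secant_point (shift n) (n - 1) \<alpha> \<rho>) \<noteq> 0"
    and ratio: "\<And>j. j \<in> I \<Longrightarrow> j \<noteq> corner \<Longrightarrow>
       \<rho> 0 ^ shift n j * \<rho> 1 ^ shift n corner \<noteq> \<rho> 0 ^ shift n corner * \<rho> 1 ^ shift n j"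
    using exists_generic_toeplitz[OF straight_line_axioms[unfolded I_def] deg] unfolding I_def corner_def by blast
  define x0 where "x0 = secant_point (shift n) (n - 1) \<alpha> \<rho>"
  define pl where "pl = plane n (\<rho> 0) (\<rho> 1)"
  obtain W where causal: "\<And>\<beta> \<beta>' m. \<beta> \<inter> {..<m} = \<beta>' \<inter> {..<m} \<Longrightarrow> W \<beta> m = W \<beta>' m"
    and W: "\<And>\<beta> m. \<beta> \<subseteq> {..<length ns} \<Longrightarrow> m < length ns \<Longrightarrow>
       (exact_result ns \<beta> x0 (W \<beta>) m \<noteq> 0 \<and>
        norm (W \<beta> m - exact_result ns \<beta> x0 (W \<beta>) m) < \<epsilon> * norm (exact_result ns \<beta> x0 (W \<beta>) m)) \<or>
       (W \<beta> m = 0 \<and> (\<forall>x. exact_result ns \<beta> x (W \<beta>) m = 0))"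
    using universal_history[OF gen eps] unfolding x0_def by blast

  \<comment> \<open>A direction for each diagonal \<open>j\<close> off the corner: it moves the corner entry and fixes diagonal \<open>j\<close>.\<close>
  have "\<forall>j. \<exists>f. j \<in> I \<longrightarrow> j \<noteq> corner \<longrightarrow> pl f corner = 1 \<and> pl f j = 0"
    using plane_interpolation[OF ratio] unfolding pl_def by metis
  from choice[OF this] obtain f where
    "\<forall>j. j \<in> I \<longrightarrow> j \<noteq> corner \<longrightarrow> pl (f j) corner = 1 \<and> pl (f j) j = 0" ..
  then have f: "pl (f j) corner = 1" "pl (f j) j = 0" if "j \<in> I" "j \<noteq> corner" for j
    using that by blast+
  define F where "F = insert 0 (f ` (I - {corner}))"
  have F_fin: "finite F" using I_fin by (simp add: F_def)
  obtain enc :: "nat set \<Rightarrow> nat" and r where enc: "enc ` Pow {..<length ns} = {i. i < r}" "inj_on enc (Pow {..<length ns})"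
    using finite_imp_inj_to_nat_seg[of "Pow {..<length ns}"] by auto
  obtain S where S: "gallai_family F r S" using gallai[OF F_fin] by blast
  then have S_fin: "finite S" by (simp add: gallai_family_def)

  \<comment> \<open>The displacement of the future nonsingular point: \<open>snd h\<close> times any direction \<open>f j\<close> moves the corner
    entry by the same amount.\<close>
  define perturbed where "perturbed h i = pl (fst h) i + (if i = corner then of_nat (snd h) else 0)" for h :: "(complex \<times> complex) \<times> nat" and i
  define D where "D = (\<lambda>(h, g). pl (homothet h g)) ` (S \<times> F) \<union> perturbed ` S"
  have D_fin: "finite D" using S_fin F_fin by (simp add: D_def)
  \<comment> \<open>All the finitely many displacements that matter are scaled into the neighbourhood of the generic
    point in which the prepared computed values remain feasible.\<close>
  have "eventually (\<lambda>s. s \<noteq> 0 \<and> (\<forall>g\<in>D. corner_minor n (\<lambda>i. x0 i + s * g i) \<noteq> 0) \<and>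
      (\<forall>g\<in>D. \<forall>\<beta>\<in>Pow {..<length ns}. feasible \<epsilon> \<beta> (W \<beta>) (\<lambda>i. x0 i + s * g i))) (at 0)"
  proof (intro eventually_conj eventually_ball_finite ballI D_fin)
    show "eventually (\<lambda>s::complex. s \<noteq> 0) (at 0)" by (rule eventually_neq_at_within)
    show "eventually (\<lambda>s. corner_minor n (\<lambda>i. x0 i + s * g i) \<noteq> 0) (at 0)" for g
    proof (rule polynomial_fun_eventually_nonzero)
      show "polynomial_fun (\<lambda>s. corner_minor n (\<lambda>i. x0 i + s * g i))"
        by (intro polynomial_fun_corner_minor polynomial_fun_add polynomial_fun_mult) simp_all
      show "corner_minor n (\<lambda>i. x0 i + 0 * g i) \<noteq> 0" using minor by (simp add: x0_def)
    qed
    show "eventually (\<lambda>s. feasible \<epsilon> \<beta> (W \<beta>) (\<lambda>i. x0 i + s * g i)) (at 0)"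
      if "\<beta> \<in> Pow {..<length ns}" for \<beta> g
      by (rule feasible_nearby[OF W eps]) (use that in auto)
  qed simp
  from eventually_happens'[OF at_neq_bot this] obtain s where s: "s \<noteq> 0"
    and near_minor: "\<And>g. g \<in> D \<Longrightarrow> corner_minor n (\<lambda>i. x0 i + s * g i) \<noteq> 0"
    and near: "\<And>g \<beta>. g \<in> D \<Longrightarrow> \<beta> \<subseteq> {..<length ns} \<Longrightarrow> feasible \<epsilon> \<beta> (W \<beta>) (\<lambda>i. x0 i + s * g i)"
    by (elim exE conjE) auto
  define X where "X b = (\<lambda>i. x0 i + s * pl b i)" for b
  have X_singular: "det (toeplitz n (X b)) = 0" for b
  proof -
    have "X b = secant_point (shift n) (n - 1) (\<alpha>(0 := \<alpha> 0 + s * fst b, 1 := \<alpha> 1 + s * snd b)) \<rho>"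
      unfolding X_def x0_def pl_def using n by (intro secant_point_plane) simp
    then show ?thesis using det_toeplitz_secant[of n] n by simp
  qed

  \<comment> \<open>The colour of a point is the branching pattern of its run with the prepared computed values.\<close>
  define follows where "follows \<beta> x \<longleftrightarrow> \<beta> \<subseteq> {..<length ns} \<and>
      (\<forall>m<length ns. m \<in> \<beta> \<longleftrightarrow> comparison ns \<beta> x (W \<beta>) m)" for \<beta> x
  define pat where "pat x = (SOME \<beta>. follows \<beta> x)" for x
  have pat: "follows (pat x) x" for x
    unfolding pat_def by (rule someI_ex) (use pattern_exists[OF causal] in \<open>simp add: follows_def\<close>)
  have pat_sub: "pat x \<subseteq> {..<length ns}" for x using pat[of x] by (simp add: follows_def)
  have enc_lt: "\<forall>b. enc (pat (X b)) < r" using imageI[of "pat (X _)" "Pow {..<length ns}" enc] pat_sub unfolding enc(1) by simp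
  have "\<forall>\<chi>::complex \<times> complex \<Rightarrow> nat. (\<forall>b. \<chi> b < r) \<longrightarrow> (\<exists>h\<in>S. monochromatic \<chi> (homothet h ` F))"
    using S by (simp add: gallai_family_def)
  from mp[OF spec[OF this] enc_lt]
  obtain h where h: "h \<in> S" and mono: "monochromatic (\<lambda>b. enc (pat (X b))) (homothet h ` F)" ..
  define \<beta> where "\<beta> = pat (X (homothet h 0))"
  have same_pat: "pat (X (homothet h g)) = \<beta>" if "g \<in> F" for g
  proof -
    have "enc (pat (X (homothet h g))) = enc \<beta>"
      using mono that unfolding monochromatic_def \<beta>_def F_def by blast
    then show ?thesis by (rule inj_onD[OF enc(2)]) (use pat_sub in \<open>auto simp: \<beta>_def\<close>)
  qed
  have follows_X: "follows \<beta> (X (homothet h g))" if "g \<in> F" for g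
    using pat[of "X (homothet h g)"] same_pat[OF that] by simp
  have \<beta>_sub: "\<beta> \<subseteq> {..<length ns}" unfolding \<beta>_def by (rule pat_sub)

  \<comment> \<open>The corner entry of \<open>y\<close> agrees with that of every point in direction \<open>f j\<close>, its other
    entries agree with those of the base point of the configuration.\<close>
  define y where "y = (\<lambda>i. x0 i + s * perturbed h i)"
  have pairs: "\<exists>g\<in>F. X (homothet h g) v = y v \<and> X (homothet h g) v' = y v'" if "v \<in> I" "v' \<in> I" for v v'
  proof -
    have off: "X (homothet h 0) i = y i" if "i \<noteq> corner" for i
      using that by (simp add: X_def y_def perturbed_def homothet_def)
    have at: "X (homothet h (f j)) corner = y corner" "X (homothet h (f j)) j = y j" if "j \<in> I" "j \<noteq> corner" for j
      using that f[OF that] by (simp_all add: X_def y_def perturbed_def pl_def plane_homothet)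
    have f_F: "f j \<in> F" if "j \<in> I" "j \<noteq> corner" for j using that by (simp add: F_def)
    have zero_F: "0 \<in> F" by (simp add: F_def)
    show ?thesis
    proof (cases "v = corner")
      case True
      show ?thesis
      proof (cases "v' = corner")
        case True
        then show ?thesis using at(1)[OF zero_I] f_F[OF zero_I] \<open>v = corner\<close> by blast
      next
        case False
        then show ?thesis using at[OF that(2) False] f_F[OF that(2) False] \<open>v = corner\<close> by blast
      qed
    next
      case False
      show ?thesis
      proof (cases "v' = corner")
        case True
        then show ?thesis using at[OF that(1) False] f_F[OF that(1) False] by blast
      next
        case F': False
        then show ?thesis using off[OF False] off[OF F'] zero_F by blast
      qed
    qed
  qed
  \<comment> \<open>A comparison sees at most two inputs, so \<open>y\<close> passes it like one of the singular points.\<close>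
  have follows_y: "follows \<beta> y"
    unfolding follows_def
  proof (intro conjI allI impI \<beta>_sub)
    fix m assume m: "m < length ns"
    from comparison_two_inputs[OF m I_ne, of \<beta> "W \<beta>"] obtain v v' where v: "v \<in> I" "v' \<in> I"
      and vv: "\<forall>x y. x v = y v \<longrightarrow> x v' = y v' \<longrightarrow> comparison ns \<beta> x (W \<beta>) m = comparison ns \<beta> y (W \<beta>) m"
      by blast
    obtain g where g: "g \<in> F" "X (homothet h g) v = y v" "X (homothet h g) v' = y v'"
      using pairs[OF v] by blast
    have "comparison ns \<beta> (X (homothet h g)) (W \<beta>) m = comparison ns \<beta> y (W \<beta>) m"
      using vv g(2,3) by blast
    moreover have "m \<in> \<beta> \<longleftrightarrow> comparison ns \<beta> (X (homothet h g)) (W \<beta>) m"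
      using follows_X[OF g(1)] m by (simp add: follows_def)
    ultimately show "m \<in> \<beta> \<longleftrightarrow> comparison ns \<beta> y (W \<beta>) m" by simp
  qed
  have result: "norm (resolved_edge ns \<beta> x (W \<beta>) (out_edge A) - det (toeplitz n x)) \<le> 1/2 * norm (det (toeplitz n x))"
    if near_x: "feasible \<epsilon> \<beta> (W \<beta>) x" and follows_x: "follows \<beta> x" for x
  proof -
    have "\<And>m. m < length ns \<Longrightarrow> m \<in> \<beta> \<longleftrightarrow> comparison ns \<beta> x (W \<beta>) m"
      using follows_x unfolding follows_def by blast
    from feasible_run[OF near_x eps out this] obtain \<delta> where "\<And>i. norm (\<delta> i) \<le> \<epsilon>"
      "edge_value (node_values (restrict x I) \<delta> ns) (out_edge A) = resolved_edge ns \<beta> x (W \<beta>) (out_edge A)"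
      by blast
    then show ?thesis using run[of \<delta> x] by (simp add: p_comp_def ns_def)
  qed
  have X_near: "feasible \<epsilon> \<beta> (W \<beta>) (X (homothet h g))" if "g \<in> F" for g
    unfolding X_def by (rule near[OF _ \<beta>_sub]) (use that h in \<open>auto simp: D_def\<close>)
  have y_near: "feasible \<epsilon> \<beta> (W \<beta>) y"
    unfolding y_def by (rule near[OF _ \<beta>_sub]) (use h in \<open>simp add: D_def\<close>)
  \<comment> \<open>At singular points an accurate algorithm returns exactly 0.\<close>
  have "resolved_edge ns \<beta> y (W \<beta>) (out_edge A) = 0"
  proof -
    obtain v where v: "v \<in> I" and dep: "\<forall>x y. x v = y v \<longrightarrow>
        resolved_edge ns \<beta> x (W \<beta>) (out_edge A) = resolved_edge ns \<beta> y (W \<beta>) (out_edge A)"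
      using resolved_edge_one_input[OF out I_ne] by blast
    obtain g where g: "g \<in> F" "X (homothet h g) v = y v" using pairs[OF v v] by blast
    have "resolved_edge ns \<beta> (X (homothet h g)) (W \<beta>) (out_edge A) = 0"
      using result[OF X_near[OF g(1)] follows_X[OF g(1)]] by (simp add: X_singular)
    then show ?thesis using dep g(2) by metis
  qed
  then have "det (toeplitz n y) = 0"
    using result[OF y_near follows_y] by simp
  moreover have "det (toeplitz n y) = (-1) ^ (n - 1) * (s * of_nat (snd h)) * corner_minor n (X (fst h))"
  proof -
    have "y = (X (fst h))(corner := X (fst h) corner + s * of_nat (snd h))"
      by (rule ext) (simp add: y_def X_def perturbed_def algebra_simps)
    then show ?thesis using det_toeplitz_corner[of n "X (fst h)", folded corner_def] n X_singular[of "fst h"] by simp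
  qed
  moreover have "corner_minor n (X (fst h)) \<noteq> 0"
  proof -
    have "pl (fst h) = pl (homothet h 0)" by (simp add: homothet_def)
    moreover have "pl (homothet h 0) \<in> D" using h by (auto simp: D_def F_def)
    ultimately show ?thesis unfolding X_def using near_minor by simp
  qed
  moreover have "snd h > 0" using S h by (simp add: gallai_family_def)
  ultimately show False using s by simp
qed

theorem corollary3p43:
  fixes R :: "(complex \<Rightarrow> complex \<Rightarrow> bool) set" and B :: "nat mpoly set"
  assumes "countable B"
    and "bounded_degree B"
    and "basic_operations \<subseteq> B"
  shows "\<not> (\<forall>n\<ge>1. accurately_evaluable R B (toeplitz_indices n)
                 (complex_space (toeplitz_indices n)) (toeplitz_det n))"
proof -
  obtain d where d: "\<forall>q\<in>B. total_degree q \<le> d" using assms(2) unfolding bounded_degree_def ..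
  have "\<not> accurately_evaluable R B (toeplitz_indices (d + 3)) (complex_space (toeplitz_indices (d + 3)))
     (toeplitz_det (d + 3))"
    by (rule toeplitz_det_not_accurately_evaluable) (use d in \<open>force\<close>)+
  moreover have "d + 3 \<ge> 1" by simp
  ultimately show ?thesis by blast
qed

end
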